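(* Let $\mathbb{F}$ be a field and let $(f_n)$ be a family of polynomials over $\mathbb{F}$. Then $(f_n)\in\mathsf{VNP}$ if and only if there is a polynomial $p$ and a family $(G_n)$ of random access branching programs such that $G_n$ computes $f_n$ and has size at most $p(n)$ for every $n$.
   Context: An arithmetic circuit over $\mathbb{F}$ is a directed acyclic graph whose gates have fanin $0$ (inputs, labeled by constants of $\mathbb{F}$ or variables) or fanin $2$ (labeled $+$ or $\times$), with a single output; size is the number of gates. $\mathsf{VP}$ is the class of polynomial families of polynomially bounded degree computed by polynomial size arithmetic circuits. $(f_n)\in\mathsf{VNP}$ if there are $(g_n)\in\mathsf{VP}$ and polynomials $p,q$ such that $f_n(X)=\sum_{e\in\{0,1\}^{p(n)}} g_n(e,X)$ for all $n$, with $X=(X_1,\dots,X_{q(n)})$. Random access branching programs (RABPs): Let $S$ be a finite symbol set. Memory operations are $\mathrm{write}(s)$, $\mathrm{delete}(s)$ for $s\in S$, and $\mathrm{nop}$. For a sequence $P$ of operations let $\mathrm{occ}(P,\mathrm{op}(s))$ be the number of occurrences of $\mathrm{op}(s)$ in $P$. $P$ is realizable if for every $s\in S$, $\mathrm{occ}(P,\mathrm{write}(s))=\mathrm{occ}(P,\mathrm{delete}(s))$ and for every prefix $P'$ of $P$, $\mathrm{occ}(P',\mathrm{write}(s))\ge\mathrm{occ}(P',\mathrm{delete}(s))$. An RABP is a directed acyclic graph with distinguished vertices $s,t$, an edge weight labeling $w:E\to\mathbb{F}\cup\{X_1,X_2,\dots\}$ and an edge labeling $\sigma$ by memory operations. A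 path has weight the product of its edge weights and is random-access-realizable if its sequence of edge operations is realizable. The RABP computes $\sum_P w(P)$ over all random-access-realizable $s$-$t$-paths $P$. Its size is its number of vertices.
   Formalization: In the definition of VNP, X is a tuple of any q(n) of the variables X_1, X_2, … rather than the first q(n); with the first q(n), the claim fails for f_n = X_{2^n}, which has branching programs of size 2. *)

theory Defs
  imports
    "HOL-Library.Poly_Mapping"
    "HOL-Library.FuncSet"
    "HOL-Library.Sublist"
    "HOL-Computational_Algebra.Polynomial"
    "Graph_Theory.Graph_Theory"
begin

section \<open>Multivariate polynomials\<close>

text \<open>
  A polynomial is a finitely supported map from monomials to coefficients, and a monomial is a
  finitely supported map from variables to exponents. The ring structure is the one of
  \<^theory>\<open>HOL-Library.Poly_Mapping\<close>.
\<close>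

type_synonym ('x, 'a) mpoly = "('x \<Rightarrow>\<^sub>0 nat) \<Rightarrow>\<^sub>0 'a"

definition mp_const :: "'a::zero \<Rightarrow> ('x, 'a) mpoly" where
  "mp_const c = Poly_Mapping.single 0 c"

definition mp_var :: "'x \<Rightarrow> ('x, 'a::zero_neq_one) mpoly" where
  "mp_var x = Poly_Mapping.single (Poly_Mapping.single x 1) 1"

definition mp_vars :: "('x, 'a::zero) mpoly \<Rightarrow> 'x set" where
  "mp_vars f = (\<Union>m\<in>Poly_Mapping.keys f. Poly_Mapping.keys m)"

text \<open>The total degree; the zero polynomial has degree 0.\<close>

definition mp_degree :: "('x, 'a::zero) mpoly \<Rightarrow> nat" where
  "mp_degree f =
     Max (insert 0
       ((\<lambda>m. \<Sum>x\<in>Poly_Mapping.keys m. Poly_Mapping.lookup m x) ` Poly_Mapping.keys f))"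

text \<open>Simultaneous substitution of polynomials for the variables.\<close>

definition mp_subst ::
  "('x \<Rightarrow> ('y, 'a) mpoly) \<Rightarrow> ('x, 'a) mpoly \<Rightarrow> ('y, 'a::comm_ring_1) mpoly" where
  "mp_subst \<theta> f =
     (\<Sum>m\<in>Poly_Mapping.keys f.
        mp_const (Poly_Mapping.lookup f m) *
        (\<Prod>x\<in>Poly_Mapping.keys m. \<theta> x ^ Poly_Mapping.lookup m x))"


section \<open>Arithmetic circuits\<close>

datatype ('x, 'a) input = Constant 'a | Variable 'x

fun input_poly :: "('x, 'a::zero_neq_one) input \<Rightarrow> ('x, 'a) mpoly" where
  "input_poly (Constant c) = mp_const c"
| "input_poly (Variable x) = mp_var x"

text \<open>
  A fanin-2 gate names its two predecessors. They may coincide, which stands for a pair of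
  parallel edges.
\<close>

datatype ('v, 'x, 'a) gate = Input "('x, 'a) input" | Plus 'v 'v | Times 'v 'v

fun predecessors :: "('v, 'x, 'a) gate \<Rightarrow> 'v set" where
  "predecessors (Input i) = {}"
| "predecessors (Plus u v) = {u, v}"
| "predecessors (Times u v) = {u, v}"

record ('v, 'x, 'a) circuit =
  gates :: "'v set"
  gate_label :: "'v \<Rightarrow> ('v, 'x, 'a) gate"
  output_gate :: 'v

definition circuit_edges :: "('v, 'x, 'a) circuit \<Rightarrow> 'v rel" where
  "circuit_edges C = {(u, v). v \<in> gates C \<and> u \<in> predecessors (gate_label C v)}"

definition is_circuit :: "('v, 'x, 'a) circuit \<Rightarrow> bool" where
  "is_circuit C \<longleftrightarrow>
     finite (gates C) \<and>
     circuit_edges C \<subseteq> gates C \<times> gates C \<and>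
     acyclic (circuit_edges C) \<and>
     output_gate C \<in> gates C"

inductive gate_computes ::
  "('v, 'x, 'a::comm_ring_1) circuit \<Rightarrow> 'v \<Rightarrow> ('x, 'a) mpoly \<Rightarrow> bool" for C where
  "gate_label C v = Input i \<Longrightarrow> gate_computes C v (input_poly i)"
| "gate_label C v = Plus u w \<Longrightarrow> gate_computes C u f \<Longrightarrow> gate_computes C w g \<Longrightarrow>
     gate_computes C v (f + g)"
| "gate_label C v = Times u w \<Longrightarrow> gate_computes C u f \<Longrightarrow> gate_computes C w g \<Longrightarrow>
     gate_computes C v (f * g)"

definition circuit_computes ::
  "('v, 'x, 'a::comm_ring_1) circuit \<Rightarrow> ('x, 'a) mpoly \<Rightarrow> bool" where
  "circuit_computes C f \<longleftrightarrow> is_circuit C \<and> gate_computes C (output_gate C) f"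

definition circuit_size :: "('v, 'x, 'a) circuit \<Rightarrow> nat" where
  "circuit_size C = card (gates C)"

lemma gate_computes_unique:
  assumes "gate_computes C v f" "gate_computes C v g"
  shows "f = g"
  using assms
proof (induction arbitrary: g rule: gate_computes.induct)
  case (1 v i)
  show ?case using 1(2) by (rule gate_computes.cases) (use 1(1) in auto)
next
  case (2 v u w f1 f2)
  show ?case using 2(6) by (rule gate_computes.cases) (use 2(1,4,5) in auto)
next
  case (3 v u w f1 f2)
  show ?case using 3(6) by (rule gate_computes.cases) (use 3(1,4,5) in auto)
qed

lemma gate_computes_exists:
  assumes "is_circuit C" "v \<in> gates C"
  shows "\<exists>f. gate_computes C v f"
proof -
  have "finite (circuit_edges C)"
    using assms(1) unfolding is_circuit_def by (meson finite_SigmaI finite_subset)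
  then have "wf (circuit_edges C)"
    using assms(1) unfolding is_circuit_def by (simp add: finite_acyclic_wf)
  then show ?thesis using assms(2)
  proof (induction v rule: wf_induct_rule)
    case (less v)
    have pred: "\<exists>f. gate_computes C u f" if "u \<in> predecessors (gate_label C v)" for u
    proof -
      have "(u, v) \<in> circuit_edges C" using that less.prems by (simp add: circuit_edges_def)
      moreover have "u \<in> gates C" using calculation assms(1) unfolding is_circuit_def by blast
      ultimately show ?thesis by (rule less.IH)
    qed
    show ?case
    proof (cases "gate_label C v")
      case (Input i)
      then show ?thesis by (blast intro: gate_computes.intros)
    next
      case (Plus u w)
      obtain f g where "gate_computes C u f" "gate_computes C w g"
        using pred[of u] pred[of w] Plus by auto
      then show ?thesis using Plus by (blast intro: gate_computes.intros)
    next
      case (Times u w)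
      obtain f g where "gate_computes C u f" "gate_computes C w g"
        using pred[of u] pred[of w] Times by auto
      then show ?thesis using Times by (blast intro: gate_computes.intros)
    qed
  qed
qed


section \<open>The classes VP and VNP\<close>

definition VP :: "(nat \<Rightarrow> ('x, 'a::field) mpoly) set" where
  "VP = {f.
     (\<exists>d :: nat poly. \<forall>n. mp_degree (f n) \<le> poly d n) \<and>
     (\<exists>(s :: nat poly) (C :: nat \<Rightarrow> (nat, 'x, 'a) circuit).
        \<forall>n. circuit_computes (C n) (f n) \<and> circuit_size (C n) \<le> poly s n)}"

text \<open>
  The supply of variables is \<open>X\<^sub>0, X\<^sub>1, X\<^sub>2, \<dots>\<close>, indexed by the natural numbers. The polynomial
  \<open>g n\<close> is over the disjoint union of the Boolean variables \<open>Inl i\<close>, \<open>i < p(n)\<close>, and the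
  variables \<open>Inr x\<close>, \<open>x \<in> X n\<close>, of which there are \<open>q(n)\<close>. Which \<open>q(n)\<close> variables of the
  supply occur is immaterial: requiring them to be the first \<open>q(n)\<close> ones would, for instance,
  exclude the family \<open>X\<^bsub>2^n\<^esub>\<close> of single variables from VNP although it lies in VP.
\<close>

definition VNP :: "(nat \<Rightarrow> (nat, 'a::field) mpoly) set" where
  "VNP = {f. \<exists>g \<in> VP. \<exists>(p :: nat poly) (q :: nat poly) (X :: nat \<Rightarrow> nat set).
     \<forall>n. finite (X n) \<and> card (X n) = poly q n \<and>
         mp_vars (g n) \<subseteq> Inl ` {..<poly p n} \<union> Inr ` X n \<and>
         f n = (\<Sum>e \<in> {..<poly p n} \<rightarrow>\<^sub>E {0, 1}.
                  mp_subst (case_sum (\<lambda>i. mp_const (e i)) mp_var) (g n))}"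


section \<open>Random access branching programs\<close>

datatype 's memop = Write 's | Delete 's | Nop

definition realizable :: "'s set \<Rightarrow> 's memop list \<Rightarrow> bool" where
  "realizable S P \<longleftrightarrow>
     (\<forall>s\<in>S. count_list P (Write s) = count_list P (Delete s) \<and>
       (\<forall>P'. prefix P' P \<longrightarrow> count_list P' (Write s) \<ge> count_list P' (Delete s)))"

text \<open>
  The underlying digraph has no parallel edges, so the number of vertices bounds the size of the
  whole program. The symbol set is part of the program and may vary along a family.
\<close>

record ('v, 's, 'x, 'a) rabp =
  rabp_graph :: "'v pair_pre_digraph"
  rabp_source :: 'v
  rabp_sink :: 'v
  rabp_weight :: "'v \<times> 'v \<Rightarrow> ('x, 'a) input"
  rabp_symbols :: "'s set"
  rabp_op :: "'v \<times> 'v \<Rightarrow> 's memop"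

definition is_rabp :: "('v, 's, 'x, 'a) rabp \<Rightarrow> bool" where
  "is_rabp G \<longleftrightarrow>
     pair_fin_digraph (rabp_graph G) \<and>
     acyclic (parcs (rabp_graph G)) \<and>
     rabp_source G \<in> pverts (rabp_graph G) \<and>
     rabp_sink G \<in> pverts (rabp_graph G) \<and>
     finite (rabp_symbols G) \<and>
     (\<forall>e \<in> parcs (rabp_graph G). set_memop (rabp_op G e) \<subseteq> rabp_symbols G)"

definition rabp_realizable_paths :: "('v, 's, 'x, 'a) rabp \<Rightarrow> ('v \<times> 'v) list set" where
  "rabp_realizable_paths G =
     {P. pre_digraph.apath (with_proj (rabp_graph G)) (rabp_source G) P (rabp_sink G) \<and>
         realizable (rabp_symbols G) (map (rabp_op G) P)}"

definition rabp_path_weight ::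
  "('v, 's, 'x, 'a::comm_ring_1) rabp \<Rightarrow> ('v \<times> 'v) list \<Rightarrow> ('x, 'a) mpoly" where
  "rabp_path_weight G P = prod_list (map (\<lambda>e. input_poly (rabp_weight G e)) P)"

definition rabp_computes ::
  "('v, 's, 'x, 'a::comm_ring_1) rabp \<Rightarrow> ('x, 'a) mpoly \<Rightarrow> bool" where
  "rabp_computes G f \<longleftrightarrow>
     is_rabp G \<and> f = (\<Sum>P \<in> rabp_realizable_paths G. rabp_path_weight G P)"

definition rabp_size :: "('v, 's, 'x, 'a) rabp \<Rightarrow> nat" where
  "rabp_size G = card (pverts (rabp_graph G))"

lemma finite_rabp_realizable_paths:
  assumes "is_rabp G"
  shows "finite (rabp_realizable_paths G)"
proof -
  interpret pair_fin_digraph "rabp_graph G" using assms by (simp add: is_rabp_def)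
  have "finite {P. apath (rabp_source G) P (rabp_sink G)}" by (rule apaths_finite)
  then show ?thesis unfolding rabp_realizable_paths_def by (rule rev_finite_subset) auto
qed

end

theory Submission
  imports Defs "HOL-Library.Multiset"
begin

text \<open>
  From VNP to programs: process the gates of the circuit in topological order, the output first.
  The memory is a multiset of symbols \<open>(v, i)\<close>, each standing for a factor that is the homogeneous
  component of degree \<open>i\<close> of gate \<open>v\<close>; processing such a symbol deletes it and writes the symbols of
  one summand of its expansion. Components of degree 0 are constants and become edge weights, so the
  degrees of the symbols in memory never exceed the degree of the polynomial in total, and a loop
  that many rounds long handles all copies of a symbol. Since multiplication commutes, no
  order of the memory is needed. What remains are copies of the Boolean variables; a variable
  occurring \<open>k\<close> times contributes \<open>0\<^sup>k + 1\<^sup>k\<close>, and two parallel branches produce this sum.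

  From programs to VNP: guess the walk in unary, one Boolean variable per time and vertex. A
  product over times tests that exactly one vertex is visited at each time and collects the edge
  weights, and for every symbol a dynamic program over its number of copies in memory tests
  realizability.
\<close>

section \<open>Evaluation, grading and degree of polynomials\<close>

text \<open>The degree bound in \<open>VP\<close> concerns the output only: inside a small circuit
  degrees may be exponential. Homogeneous components remove this obstacle, since expanding a
  component of degree \<open>i\<close> never needs a degree above \<open>i\<close>; and as only
  positive degrees enter the memory, at most \<open>D\<close> symbols are present at any time. A
  program cannot test whether a symbol is absent, so it guesses when to leave a loop. Staying too
  long attempts an impossible deletion; leaving too early keeps a symbol that nothing later deletes.
  Either way the walk is not realizable and adds nothing. This forces the topological order: the
  loop of a symbol must come after every loop that writes it. The Boolean sum must stay outside the
  product of the symbols, because all copies of a variable share one value. Hence the variables wait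
  in memory until all their copies have been collected. In the converse direction the Boolean sum
  ranges over all assignments, so the polynomial has to vanish on those that encode no walk.\<close>

definition mp_eval :: "('a \<Rightarrow> 'r) \<Rightarrow> ('x \<Rightarrow> 'r) \<Rightarrow> ('x, 'a::zero) mpoly \<Rightarrow> 'r::comm_ring_1" where
  "mp_eval h \<theta> f =
     (\<Sum>m\<in>Poly_Mapping.keys f. h (Poly_Mapping.lookup f m) *
        (\<Prod>x\<in>Poly_Mapping.keys m. \<theta> x ^ Poly_Mapping.lookup m x))"

lemma mp_subst_eq_eval: "mp_subst \<theta> = mp_eval mp_const \<theta>"
  by (simp add: fun_eq_iff mp_subst_def mp_eval_def)

definition mon_eval :: "('x \<Rightarrow> 'r::comm_monoid_mult) \<Rightarrow> ('x \<Rightarrow>\<^sub>0 nat) \<Rightarrow> 'r" where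
  "mon_eval \<theta> m = (\<Prod>x\<in>Poly_Mapping.keys m. \<theta> x ^ Poly_Mapping.lookup m x)"

lemma mon_eval_superset:
  assumes "finite A" "Poly_Mapping.keys m \<subseteq> A"
  shows "mon_eval \<theta> m = (\<Prod>x\<in>A. \<theta> x ^ Poly_Mapping.lookup m x)"
  unfolding mon_eval_def
  by (rule prod.mono_neutral_left) (use assms in \<open>auto simp: in_keys_iff\<close>)

lemma mon_eval_0 [simp]: "mon_eval \<theta> 0 = 1"
  by (simp add: mon_eval_def)

lemma mon_eval_single [simp]: "mon_eval \<theta> (Poly_Mapping.single x n) = \<theta> x ^ n"
  by (cases "n = 0") (simp_all add: mon_eval_def)

lemma mon_eval_add: "mon_eval \<theta> (m + m') = mon_eval \<theta> m * mon_eval \<theta> m'"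
proof -
  let ?A = "Poly_Mapping.keys m \<union> Poly_Mapping.keys m'"
  have "Poly_Mapping.keys (m + m') \<subseteq> ?A" by (rule keys_add)
  then show ?thesis
    by (simp add: mon_eval_superset[where A = ?A] lookup_add power_add prod.distrib)
qed

lemma mp_eval_altdef:
  "mp_eval h \<theta> f = (\<Sum>m\<in>Poly_Mapping.keys f. h (Poly_Mapping.lookup f m) * mon_eval \<theta> m)"
  by (simp add: mp_eval_def mon_eval_def)

lemma mp_eval_superset:
  assumes "finite A" "Poly_Mapping.keys f \<subseteq> A" "h 0 = 0"
  shows "mp_eval h \<theta> f = (\<Sum>m\<in>A. h (Poly_Mapping.lookup f m) * mon_eval \<theta> m)"
  unfolding mp_eval_def mon_eval_def
  by (rule sum.mono_neutral_left) (use assms in \<open>auto simp: in_keys_iff\<close>)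

lemma mpoly_sum_monomials:
  "f = (\<Sum>m\<in>Poly_Mapping.keys f. Poly_Mapping.single m (Poly_Mapping.lookup f m))"
proof (rule poly_mapping_eqI)
  fix k
  show "Poly_Mapping.lookup f k = Poly_Mapping.lookup
          (\<Sum>m\<in>Poly_Mapping.keys f. Poly_Mapping.single m (Poly_Mapping.lookup f m)) k"
    by (auto simp: lookup_sum lookup_single when_def in_keys_iff)
qed

text \<open>Two instances are used: constants sent to polynomials give \<open>mp_subst\<close>,
  constants sent to univariate polynomials over them give the grading by degree.\<close>

locale ring_morphism =
  fixes h :: "'a::comm_ring_1 \<Rightarrow> 'r::comm_ring_1"
  assumes h_0: "h 0 = 0" and h_1: "h 1 = 1"
    and h_add: "h (a + b) = h a + h b" and h_mult: "h (a * b) = h a * h b"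
begin

lemma eval_0 [simp]: "mp_eval h \<theta> 0 = 0"
  by (simp add: mp_eval_def)

lemma eval_single [simp]: "mp_eval h \<theta> (Poly_Mapping.single m c) = h c * mon_eval \<theta> m"
  by (cases "c = 0") (simp_all add: mp_eval_def mon_eval_def h_0)

lemma eval_add [simp]: "mp_eval h \<theta> (f + g) = mp_eval h \<theta> f + mp_eval h \<theta> g"
proof -
  let ?A = "Poly_Mapping.keys f \<union> Poly_Mapping.keys g"
  have "Poly_Mapping.keys (f + g) \<subseteq> ?A" by (rule keys_add)
  then show ?thesis
    by (simp add: mp_eval_superset[where A = ?A] h_0 lookup_add h_add distrib_right sum.distrib)
qed

lemma eval_sum [simp]: "mp_eval h \<theta> (\<Sum>i\<in>I. f i) = (\<Sum>i\<in>I. mp_eval h \<theta> (f i))"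
  by (induction I rule: infinite_finite_induct) simp_all

lemma eval_mult [simp]: "mp_eval h \<theta> (f * g) = mp_eval h \<theta> f * mp_eval h \<theta> g"
proof -
  have "f * g = (\<Sum>m\<in>Poly_Mapping.keys f. \<Sum>m'\<in>Poly_Mapping.keys g.
      Poly_Mapping.single (m + m') (Poly_Mapping.lookup f m * Poly_Mapping.lookup g m'))"
    using sum_product[of "\<lambda>m. Poly_Mapping.single m (Poly_Mapping.lookup f m)" "Poly_Mapping.keys f"
        "\<lambda>m. Poly_Mapping.single m (Poly_Mapping.lookup g m)" "Poly_Mapping.keys g"]
    by (simp add: mpoly_sum_monomials[symmetric] mult_single)
  then have "mp_eval h \<theta> (f * g) = (\<Sum>m\<in>Poly_Mapping.keys f. \<Sum>m'\<in>Poly_Mapping.keys g.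
      h (Poly_Mapping.lookup f m * Poly_Mapping.lookup g m') * mon_eval \<theta> (m + m'))"
    by (simp only: eval_sum eval_single)
  also have "\<dots> = mp_eval h \<theta> f * mp_eval h \<theta> g"
    by (simp add: mp_eval_altdef h_0 sum_product
        mon_eval_add h_mult mult_ac)
  finally show ?thesis .
qed

lemma eval_const [simp]: "mp_eval h \<theta> (mp_const c) = h c"
  by (simp add: mp_const_def)

lemma eval_var [simp]: "mp_eval h \<theta> (mp_var x) = \<theta> x"
  by (simp add: mp_var_def h_1)

lemma eval_1 [simp]: "mp_eval h \<theta> 1 = 1"
  using eval_const[of _ 1] by (simp add: mp_const_def h_1)

lemma eval_prod [simp]: "mp_eval h \<theta> (\<Prod>i\<in>I. f i) = (\<Prod>i\<in>I. mp_eval h \<theta> (f i))"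
  by (induction I rule: infinite_finite_induct) simp_all

end

lemma mp_const_0 [simp]: "mp_const 0 = 0"
  and mp_const_1 [simp]: "mp_const 1 = 1"
  and mp_const_add: "mp_const (a + b) = mp_const a + mp_const b"
  by (simp_all add: mp_const_def single_add)

lemma mp_const_mult: "mp_const (a * b) = mp_const a * mp_const (b::'a::comm_ring_1)"
  by (simp add: mp_const_def mult_single)

interpretation mp_const: ring_morphism "mp_const :: 'a \<Rightarrow> ('x, 'a::comm_ring_1) mpoly"
  by unfold_locales (simp_all add: mp_const_add mp_const_mult)

text \<open>Multiplying every variable by a fresh \<open>z\<close> turns the homogeneous components of a polynomial
  into the coefficients of a univariate polynomial in \<open>z\<close>.\<close>

definition grading :: "('x \<Rightarrow> ('y, 'a) mpoly) \<Rightarrow> ('x, 'a::comm_ring_1) mpoly \<Rightarrow> ('y, 'a) mpoly poly"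
  where "grading \<theta> = mp_eval (\<lambda>c. [:mp_const c:]) (\<lambda>x. monom (\<theta> x) 1)"

interpretation grading: ring_morphism "\<lambda>c. [:mp_const c :: ('y, 'a::comm_ring_1) mpoly:]"
  by unfold_locales (simp_all add: mp_const_add mp_const_mult)

definition mon_degree :: "('x \<Rightarrow>\<^sub>0 nat) \<Rightarrow> nat" where
  "mon_degree m = (\<Sum>x\<in>Poly_Mapping.keys m. Poly_Mapping.lookup m x)"

lemma mon_degree_add: "mon_degree (m + m') = mon_degree m + mon_degree m'"
proof -
  let ?A = "Poly_Mapping.keys m \<union> Poly_Mapping.keys m'"
  have *: "mon_degree k = (\<Sum>x\<in>?A. Poly_Mapping.lookup k x)" if "Poly_Mapping.keys k \<subseteq> ?A" for k
    unfolding mon_degree_def by (rule sum.mono_neutral_left) (use that in \<open>auto simp: in_keys_iff\<close>)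
  have "Poly_Mapping.keys (m + m') \<subseteq> ?A" by (rule keys_add)
  then show ?thesis by (simp add: * lookup_add sum.distrib)
qed

lemma mp_degree_le_iff: "mp_degree f \<le> d \<longleftrightarrow> (\<forall>m\<in>Poly_Mapping.keys f. mon_degree m \<le> d)"
  by (auto simp: mp_degree_def mon_degree_def)

lemma mon_degree_eq_0_iff: "mon_degree m = 0 \<longleftrightarrow> m = 0"
  by (auto simp: mon_degree_def in_keys_iff intro!: poly_mapping_eqI)

lemma mon_eval_monom: "mon_eval (\<lambda>x. monom (\<theta> x) 1) m = monom (mon_eval \<theta> m) (mon_degree m)"
proof -
  have "(\<Prod>x\<in>A. monom (\<theta> x) 1 ^ k x) = monom (\<Prod>x\<in>A. \<theta> x ^ k x) (sum k A)" for A k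
    by (induction A rule: infinite_finite_induct) (simp_all add: monom_power mult_monom monom_0)
  then show ?thesis by (simp add: mon_eval_def mon_degree_def)
qed

lemma grading_altdef:
  "grading \<theta> f = (\<Sum>m\<in>Poly_Mapping.keys f.
     monom (mp_const (Poly_Mapping.lookup f m) * mon_eval \<theta> m) (mon_degree m))"
  by (simp add: grading_def mp_eval_altdef mon_eval_monom
      smult_monom del: One_nat_def)

lemma grading_poly_1: "poly (grading \<theta> f) 1 = mp_subst \<theta> f"
  by (simp add: grading_altdef mp_subst_eq_eval mp_eval_altdef
      poly_sum poly_monom)

lemma degree_grading: "degree (grading \<theta> f) \<le> mp_degree f"
  unfolding grading_altdef
proof (rule degree_sum_le)
  fix m assume "m \<in> Poly_Mapping.keys f"
  then have "mon_degree m \<le> mp_degree f" using mp_degree_le_iff by blast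
  then show "degree (monom (mp_const (Poly_Mapping.lookup f m) * mon_eval \<theta> m) (mon_degree m))
      \<le> mp_degree f"
    by (meson degree_monom_le order_trans)
qed simp

text \<open>Only the monomial \<open>0\<close> has degree 0. The value does not depend on
  \<open>\<theta>\<close>, hence not on the Boolean assignment, which is what allows it to serve as
  an edge weight.\<close>

lemma grading_coeff_0: "coeff (grading \<theta> f) 0 = mp_const (Poly_Mapping.lookup f 0)"
proof -
  have "coeff (grading \<theta> f) 0 =
      (\<Sum>m\<in>Poly_Mapping.keys f. if m = 0 then mp_const (Poly_Mapping.lookup f m) else 0)"
    unfolding grading_altdef coeff_sum
    by (rule sum.cong) (auto simp: mon_degree_eq_0_iff)
  also have "\<dots> = mp_const (Poly_Mapping.lookup f 0)"
    by (simp add: in_keys_iff)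
  finally show ?thesis .
qed

text \<open>Setting the fresh variable to 1 undoes the grading, and no component above
  \<open>d\<close> is lost.\<close>

lemma mp_subst_eq_sum_coeff:
  assumes "mp_degree f \<le> d"
  shows "mp_subst \<theta> f = (\<Sum>i\<le>d. coeff (grading \<theta> f) i)"
proof -
  have "degree (grading \<theta> f) \<le> d"
    using degree_grading assms by (rule order_trans)
  then have "poly (grading \<theta> f) 1 = (\<Sum>i\<le>d. coeff (grading \<theta> f) i)"
    unfolding poly_altdef by (intro sum.mono_neutral_cong_left) (auto simp: coeff_eq_0)
  then show ?thesis by (simp add: grading_poly_1)
qed

section \<open>Degree and variables under sums and products\<close>

lemma mp_degree_add: "mp_degree (f + g) \<le> max (mp_degree f) (mp_degree g)"
  unfolding mp_degree_le_iff
proof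
  fix m assume "m \<in> Poly_Mapping.keys (f + g)"
  then have "m \<in> Poly_Mapping.keys f \<or> m \<in> Poly_Mapping.keys g"
    using keys_add[of f g] by blast
  then show "mon_degree m \<le> max (mp_degree f) (mp_degree g)"
    using mp_degree_le_iff le_max_iff_disj by blast
qed

lemma mp_degree_mult:
  fixes f g :: "('x, 'a::comm_ring_1) mpoly"
  shows "mp_degree (f * g) \<le> mp_degree f + mp_degree g"
  unfolding mp_degree_le_iff
proof
  fix m assume "m \<in> Poly_Mapping.keys (f * g)"
  then obtain a b where "m = a + b" "a \<in> Poly_Mapping.keys f" "b \<in> Poly_Mapping.keys g"
    using keys_mult[of f g] by blast
  moreover have "mon_degree a \<le> mp_degree f" "mon_degree b \<le> mp_degree g"
    using calculation mp_degree_le_iff by blast+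
  ultimately show "mon_degree m \<le> mp_degree f + mp_degree g"
    by (simp add: mon_degree_add)
qed

lemma mp_degree_const [simp]: "mp_degree (mp_const c) = 0"
  unfolding le_zero_eq[symmetric] mp_degree_le_iff by (auto simp: mp_const_def mon_degree_def)

lemma mp_degree_0 [simp]: "mp_degree 0 = 0"
  using mp_degree_const[of 0] by simp

lemma mp_degree_1 [simp]: "mp_degree (1 :: ('x, 'a::comm_ring_1) mpoly) = 0"
  using mp_degree_const[of "1::'a"] by simp

lemma mp_degree_var: "mp_degree (mp_var x) \<le> 1"
  by (simp add: mp_degree_le_iff mp_var_def mon_degree_def)

lemma mp_degree_sum_le:
  assumes "\<And>i. i \<in> I \<Longrightarrow> mp_degree (f i) \<le> d"
  shows "mp_degree (\<Sum>i\<in>I. f i) \<le> d"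
  using assms
proof (induction I rule: infinite_finite_induct)
  case (insert i I)
  then show ?case using mp_degree_add[of "f i" "sum f I"] by fastforce
qed simp_all

lemma mp_degree_prod_le:
  fixes f :: "'i \<Rightarrow> ('x, 'a::comm_ring_1) mpoly"
  assumes "\<And>i. i \<in> I \<Longrightarrow> mp_degree (f i) \<le> d"
  shows "mp_degree (\<Prod>i\<in>I. f i) \<le> card I * d"
  using assms
proof (induction I rule: infinite_finite_induct)
  case (insert i I)
  then show ?case using mp_degree_mult[of "f i" "prod f I"] by fastforce
qed simp_all

lemma mp_vars_add: "mp_vars (f + g) \<subseteq> mp_vars f \<union> mp_vars g"
  unfolding mp_vars_def using keys_add[of f g] by blast

lemma mp_vars_mult:
  fixes f g :: "('x, 'a::comm_ring_1) mpoly"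
  shows "mp_vars (f * g) \<subseteq> mp_vars f \<union> mp_vars g"
proof
  fix x assume "x \<in> mp_vars (f * g)"
  then obtain a b where "a \<in> Poly_Mapping.keys f" "b \<in> Poly_Mapping.keys g"
    "x \<in> Poly_Mapping.keys (a + b)"
    unfolding mp_vars_def using keys_mult[of f g] by fastforce
  then show "x \<in> mp_vars f \<union> mp_vars g"
    unfolding mp_vars_def using keys_add[of a b] by blast
qed

section \<open>Straight-line derivations\<close>

text \<open>Read as a list of gates, the witness \<open>xs\<close> is an arithmetic circuit; read as a list of vertices, it is
  a branching program built from the sink backwards.\<close>

definition dag :: "('b set \<Rightarrow> 'b \<Rightarrow> bool) \<Rightarrow> 'b set \<Rightarrow> nat \<Rightarrow> 'b set \<Rightarrow> bool" where
  "dag R A n B \<longleftrightarrow> (\<exists>xs. length xs \<le> n \<and> B \<subseteq> A \<union> set xs \<and>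
     (\<forall>i<length xs. R (A \<union> set (take i xs)) (xs ! i)))"

text \<open>Steps are monotone in what is available, so an element once derived is reused at no
  cost; thus lengths of derivations measure graphs with sharing rather than trees.\<close>

locale dag_steps =
  fixes R :: "'b set \<Rightarrow> 'b \<Rightarrow> bool"
  assumes step_mono: "R A x \<Longrightarrow> A \<subseteq> B \<Longrightarrow> R B x"
begin

lemma dag_refl: "B \<subseteq> A \<Longrightarrow> dag R A n B"
  unfolding dag_def by (rule exI[of _ "[]"]) auto

lemma dag_step: "R A x \<Longrightarrow> dag R A 1 {x}"
  unfolding dag_def by (rule exI[of _ "[x]"]) auto

lemma dag_weaken: "dag R A n B \<Longrightarrow> n \<le> n' \<Longrightarrow> B' \<subseteq> B \<Longrightarrow> dag R A n' B'"
  unfolding dag_def by (meson order_trans)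

lemma dag_trans:
  assumes "dag R A n B" "dag R (A \<union> B) m C"
  shows "dag R A (n + m) (B \<union> C)"
proof -
  obtain xs where xs: "length xs \<le> n" "B \<subseteq> A \<union> set xs"
    "\<And>i. i < length xs \<Longrightarrow> R (A \<union> set (take i xs)) (xs ! i)"
    using assms(1) unfolding dag_def by auto
  obtain ys where ys: "length ys \<le> m" "C \<subseteq> A \<union> B \<union> set ys"
    "\<And>i. i < length ys \<Longrightarrow> R (A \<union> B \<union> set (take i ys)) (ys ! i)"
    using assms(2) unfolding dag_def by auto
  have "R (A \<union> set (take i (xs @ ys))) ((xs @ ys) ! i)" if "i < length (xs @ ys)" for i
  proof (cases "i < length xs")
    case True
    then show ?thesis using xs(3) by (simp add: nth_append)
  next
    case False
    then have "R (A \<union> B \<union> set (take (i - length xs) ys)) (ys ! (i - length xs))"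
      using that ys(3) by simp
    then show ?thesis
      using False xs(2) by (auto simp: nth_append elim!: step_mono)
  qed
  moreover have "length (xs @ ys) \<le> n + m" "B \<union> C \<subseteq> A \<union> set (xs @ ys)"
    using xs ys by auto
  ultimately show ?thesis unfolding dag_def by blast
qed

lemma dag_mono_start:
  assumes "dag R A n B" "A \<subseteq> A'"
  shows "dag R A' n B"
proof -
  obtain xs where xs: "length xs \<le> n" "B \<subseteq> A \<union> set xs"
    "\<forall>i<length xs. R (A \<union> set (take i xs)) (xs ! i)"
    using assms(1) unfolding dag_def by auto
  show ?thesis
    unfolding dag_def
    by (rule exI[of _ xs]) (use xs assms(2) in \<open>auto elim!: step_mono\<close>)
qed

lemma dag_then:
  assumes "dag R A n B" "dag R (A \<union> B) m C"
  shows "dag R A (n + m) C"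
  using dag_trans[OF assms] by (rule dag_weaken) auto

lemma dag_then_step:
  assumes "dag R A n B" "R (A \<union> B) x"
  shows "dag R A (Suc n) {x}"
  using dag_then[OF assms(1) dag_step[OF assms(2)]] by simp

lemma dag_Un:
  assumes "dag R A n B" "dag R A m C"
  shows "dag R A (n + m) (B \<union> C)"
  using dag_trans[OF assms(1) dag_mono_start[OF assms(2)]] by simp

lemma dag_UN:
  assumes "finite I" "\<And>i. i \<in> I \<Longrightarrow> dag R A c (B i)"
  shows "dag R A (card I * c) (\<Union>i\<in>I. B i)"
  using assms
proof (induction I)
  case empty
  show ?case by (rule dag_refl) simp
next
  case (insert i I)
  then have "dag R A (c + card I * c) (B i \<union> (\<Union>i\<in>I. B i))"
    by (intro dag_Un) auto
  then show ?case using insert.hyps by simp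
qed

lemma dag_image:
  assumes "finite I" "\<And>i. i \<in> I \<Longrightarrow> dag R A c {f i}"
  shows "dag R A (card I * c) (f ` I)"
  using dag_UN[where B = "\<lambda>i. {f i}", OF assms] by (simp add: UNION_singleton_eq_range)

text \<open>The shape of a table filled row by row: \<open>B k\<close> is row \<open>k\<close>,
  computed from the row before it at cost \<open>c\<close>.\<close>

lemma dag_iterate:
  assumes "\<And>k. k < m \<Longrightarrow> dag R (B k) c (B (Suc k))"
  shows "dag R (B 0) (m * c) (B m)"
  using assms
proof (induction m)
  case 0
  show ?case by (rule dag_refl) simp
next
  case (Suc m)
  have "dag R (B 0) (m * c) (B m)" "dag R (B 0 \<union> B m) c (B (Suc m))"
    using Suc by (auto intro: dag_mono_start)
  from dag_then[OF this] show ?case by (simp add: add.commute)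
qed

end

section \<open>Arithmetic circuits as derivations\<close>

text \<open>The set \<open>I\<close> of admissible inputs is a parameter so that a derivation also
  controls which variables occur, as the definition of \<open>VNP\<close> demands.\<close>

inductive alg_step :: "('x, 'a::comm_ring_1) input set \<Rightarrow> ('x, 'a) mpoly set \<Rightarrow> ('x, 'a) mpoly \<Rightarrow> bool"
  for I A where
  "i \<in> I \<Longrightarrow> alg_step I A (input_poly i)"
| "f \<in> A \<Longrightarrow> g \<in> A \<Longrightarrow> alg_step I A (f + g)"
| "f \<in> A \<Longrightarrow> g \<in> A \<Longrightarrow> alg_step I A (f * g)"

interpretation alg: dag_steps "alg_step I"
  by unfold_locales (auto elim!: alg_step.cases intro: alg_step.intros)

lemma alg_sum:
  assumes "finite S" "Constant 0 \<in> I" "f ` S \<subseteq> A"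
  shows "dag (alg_step I) A (Suc (card S)) {\<Sum>i\<in>S. f i}"
  using assms(1,3)
proof (induction S)
  case empty
  have "alg_step I A (input_poly (Constant 0))"
    using assms(2) by (rule alg_step.intros)
  then show ?case using alg.dag_step by fastforce
next
  case (insert x S)
  have "alg_step I (A \<union> {\<Sum>i\<in>S. f i}) (f x + (\<Sum>i\<in>S. f i))"
    by (rule alg_step.intros) (use insert.prems in auto)
  then have "dag (alg_step I) A (Suc (Suc (card S))) {f x + (\<Sum>i\<in>S. f i)}"
    using insert.IH insert.prems by (intro alg.dag_then_step) auto
  then show ?case using insert.hyps by simp
qed

lemma alg_prod:
  assumes "finite S" "Constant 1 \<in> I" "f ` S \<subseteq> A"
  shows "dag (alg_step I) A (Suc (card S)) {\<Prod>i\<in>S. f i}"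
  using assms(1,3)
proof (induction S)
  case empty
  have "alg_step I A (input_poly (Constant 1))"
    using assms(2) by (rule alg_step.intros)
  then show ?case using alg.dag_step by fastforce
next
  case (insert x S)
  have "alg_step I (A \<union> {\<Prod>i\<in>S. f i}) (f x * (\<Prod>i\<in>S. f i))"
    by (rule alg_step.intros) (use insert.prems in auto)
  then have "dag (alg_step I) A (Suc (Suc (card S))) {f x * (\<Prod>i\<in>S. f i)}"
    using insert.IH insert.prems by (intro alg.dag_then_step) auto
  then show ?case using insert.hyps by simp
qed

lemma alg_mult:
  assumes "dag (alg_step I) A n {f}" "dag (alg_step I) A m {g}"
  shows "dag (alg_step I) A (Suc (n + m)) {f * g}"
  by (rule alg.dag_then_step[OF alg.dag_Un[OF assms]]) (auto intro: alg_step.intros)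

lemma alg_add:
  assumes "dag (alg_step I) A n {f}" "dag (alg_step I) A m {g}"
  shows "dag (alg_step I) A (Suc (n + m)) {f + g}"
  by (rule alg.dag_then_step[OF alg.dag_Un[OF assms]]) (auto intro: alg_step.intros)

lemma alg_input: "i \<in> I \<Longrightarrow> f = input_poly i \<Longrightarrow> dag (alg_step I) A 1 {f}"
  using alg.dag_step[OF alg_step.intros(1)] by simp

text \<open>Each term costs \<open>c\<close> for itself and one addition; the final 1 is the
  constant 0 from which the sum starts.\<close>

lemma alg_sum_of:
  assumes "finite S" "Constant 0 \<in> I" "\<And>i. i \<in> S \<Longrightarrow> dag (alg_step I) A c {f i}"
  shows "dag (alg_step I) A (card S * Suc c + 1) {\<Sum>i\<in>S. f i}"
  using alg.dag_then[OF alg.dag_image[OF assms(1,3)] alg_sum[OF assms(1,2)]]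
  by (simp add: algebra_simps)

lemma alg_prod_of:
  assumes "finite S" "Constant 1 \<in> I" "\<And>i. i \<in> S \<Longrightarrow> dag (alg_step I) A c {f i}"
  shows "dag (alg_step I) A (card S * Suc c + 1) {\<Prod>i\<in>S. f i}"
  using alg.dag_then[OF alg.dag_image[OF assms(1,3)] alg_prod[OF assms(1,2)]]
  by (simp add: algebra_simps)

lemma in_set_takeD_nth: "x \<in> set (take i xs) \<Longrightarrow> \<exists>j<i. j < length xs \<and> x = xs ! j"
  by (auto simp: in_set_conv_nth)

lemma alg_dag_vars:
  assumes "dag (alg_step I) {} n B" "\<And>i. i \<in> I \<Longrightarrow> mp_vars (input_poly i) \<subseteq> V" "f \<in> B"
  shows "mp_vars f \<subseteq> V"
proof -
  obtain xs where xs: "B \<subseteq> set xs" "\<And>i. i < length xs \<Longrightarrow> alg_step I (set (take i xs)) (xs ! i)"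
    using assms(1) unfolding dag_def by auto
  have "mp_vars (xs ! i) \<subseteq> V" if "i < length xs" for i
    using that
  proof (induction i rule: less_induct)
    case (less i)
    have IH: "mp_vars g \<subseteq> V" if "g \<in> set (take i xs)" for g
    proof -
      from that obtain j where "j < i" "g = xs ! j" using in_set_takeD_nth by metis
      then show ?thesis using less by auto
    qed
    show ?case
      using xs(2)[OF less.prems]
    proof cases
      case (2 f g)
      then show ?thesis using IH[of f] IH[of g] mp_vars_add[of f g] by auto
    next
      case (3 f g)
      then show ?thesis using IH[of f] IH[of g] mp_vars_mult[of f g] by auto
    qed (use assms(2) in auto)
  qed
  then show ?thesis using xs(1) assms(3) by (metis in_set_conv_nth subsetD)
qed

text \<open>Gates are list positions, not polynomials. Operands are looked up at earlier positions,
  so the edges lie inside \<open>less_than\<close> and acyclicity is immediate.\<close>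

lemma alg_dag_circuit:
  assumes "dag (alg_step I) {} n {f}"
  obtains C :: "(nat, 'x, 'a::comm_ring_1) circuit" where "circuit_computes C f" "circuit_size C \<le> n"
proof -
  obtain xs where xs: "length xs \<le> n" "f \<in> set xs"
    "\<And>i. i < length xs \<Longrightarrow> alg_step I (set (take i xs)) (xs ! i)"
    using assms unfolding dag_def by auto
  have "\<exists>g. (\<forall>j\<in>predecessors g. j < i) \<and>
      (case g of Input a \<Rightarrow> xs ! i = input_poly a
         | Plus j k \<Rightarrow> xs ! i = xs ! j + xs ! k | Times j k \<Rightarrow> xs ! i = xs ! j * xs ! k)"
    if "i < length xs" for i
    using xs(3)[OF that]
  proof cases
    case (1 a)
    then show ?thesis by (intro exI[of _ "Input a"]) simp
  next
    case (2 f g)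
    then obtain j k where "j < i" "k < i" "f = xs ! j" "g = xs ! k" using in_set_takeD_nth by metis
    then show ?thesis using 2 by (intro exI[of _ "Plus j k"]) simp
  next
    case (3 f g)
    then obtain j k where "j < i" "k < i" "f = xs ! j" "g = xs ! k" using in_set_takeD_nth by metis
    then show ?thesis using 3 by (intro exI[of _ "Times j k"]) simp
  qed
  then obtain L where L: "\<And>i j. i < length xs \<Longrightarrow> j \<in> predecessors (L i) \<Longrightarrow> j < i"
    "\<And>i. i < length xs \<Longrightarrow> (case L i of Input a \<Rightarrow> xs ! i = input_poly a
         | Plus j k \<Rightarrow> xs ! i = xs ! j + xs ! k | Times j k \<Rightarrow> xs ! i = xs ! j * xs ! k)"
    by metis
  obtain k where k: "k < length xs" "f = xs ! k" using xs(2) by (auto simp: in_set_conv_nth)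
  define C :: "(nat, 'x, 'a) circuit"
    where "C = \<lparr>gates = {..<length xs}, gate_label = L, output_gate = k\<rparr>"
  have edges: "circuit_edges C \<subseteq> less_than \<inter> {..<length xs} \<times> {..<length xs}"
    using L(1) by (force simp: circuit_edges_def C_def)
  then have "acyclic (circuit_edges C)"
    by (meson wf_acyclic wf_less_than acyclic_subset le_inf_iff)
  then have "is_circuit C" using edges k by (auto simp: is_circuit_def C_def)
  moreover have "gate_computes C i (xs ! i)" if "i < length xs" for i
    using that
  proof (induction i rule: less_induct)
    case (less i)
    have IH: "gate_computes C j (xs ! j)" if "j \<in> predecessors (L i)" for j
      using L(1)[OF less.prems that] less by auto
    show ?case
    proof (cases "L i")
      case (Input a)
      then have "gate_label C i = Input a" by (simp add: C_def)
      then show ?thesis using gate_computes.intros(1) L(2)[OF less.prems] Input by fastforce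
    next
      case (Plus j k)
      then have "gate_label C i = Plus j k" by (simp add: C_def)
      then show ?thesis
        using gate_computes.intros(2) L(2)[OF less.prems] Plus IH[of j] IH[of k] by fastforce
    next
      case (Times j k)
      then have "gate_label C i = Times j k" by (simp add: C_def)
      then show ?thesis
        using gate_computes.intros(3) L(2)[OF less.prems] Times IH[of j] IH[of k] by fastforce
    qed
  qed
  ultimately have "circuit_computes C f" using k by (simp add: circuit_computes_def C_def)
  moreover have "circuit_size C \<le> n" using xs(1) by (simp add: circuit_size_def C_def)
  ultimately show thesis by (rule that)
qed

section \<open>Memory and walks of branching programs\<close>

fun mem_step :: "'s memop \<Rightarrow> 's multiset \<Rightarrow> 's multiset option" where
  "mem_step (Write s) M = Some (add_mset s M)"
| "mem_step (Delete s) M = (if s \<in># M then Some (M - {#s#}) else None)"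
| "mem_step Nop M = Some M"

fun mem_run :: "'s memop list \<Rightarrow> 's multiset \<Rightarrow> 's multiset option" where
  "mem_run [] M = Some M"
| "mem_run (a # P) M = (case mem_step a M of None \<Rightarrow> None | Some M' \<Rightarrow> mem_run P M')"

text \<open>Realizability for one symbol when \<open>k\<close> copies are already stored; unlike the
  case \<open>k = 0\<close>, this form survives splitting off the first operation.\<close>

definition balanced :: "'s \<Rightarrow> nat \<Rightarrow> 's memop list \<Rightarrow> bool" where
  "balanced s k P \<longleftrightarrow> k + count_list P (Write s) = count_list P (Delete s) \<and>
     (\<forall>P'. prefix P' P \<longrightarrow> k + count_list P' (Write s) \<ge> count_list P' (Delete s))"

lemma realizable_iff_balanced: "realizable S P \<longleftrightarrow> (\<forall>s\<in>S. balanced s 0 P)"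
  by (simp add: realizable_def balanced_def)

lemma all_prefix_Cons: "(\<forall>P'. prefix P' (a # P) \<longrightarrow> Q P') \<longleftrightarrow> Q [] \<and> (\<forall>P'. prefix P' P \<longrightarrow> Q (a # P'))"
  by (auto simp: prefix_Cons)

lemma balanced_Nil: "balanced s k [] \<longleftrightarrow> k = 0"
  by (simp add: balanced_def)

lemma balanced_Write: "balanced s k (Write t # P) \<longleftrightarrow> balanced s (if s = t then Suc k else k) P"
  by (auto simp: balanced_def all_prefix_Cons)

lemma balanced_Nop: "balanced s k (Nop # P) \<longleftrightarrow> balanced s k P"
  by (auto simp: balanced_def all_prefix_Cons)

lemma balanced_Delete:
  "balanced s k (Delete t # P) \<longleftrightarrow> (if s = t then k > 0 \<and> balanced s (k - 1) P else balanced s k P)"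
proof (cases "s = t")
  case True
  show ?thesis
  proof (cases k)
    case 0
    \<comment> \<open>With no copy stored, the prefix of length one already violates the
      inequality.\<close>
    have "prefix [Delete t] (Delete t # P)" by simp
    then have "\<not> balanced t 0 (Delete t # P)"
      unfolding balanced_def by (metis (no_types, lifting) add_0 count_list.simps memop.distinct(1)
          not_one_le_zero)
    then show ?thesis using 0 True by simp
  next
    case (Suc j)
    then show ?thesis using True by (auto simp: balanced_def all_prefix_Cons)
  qed
qed (auto simp: balanced_def all_prefix_Cons)

lemmas balanced_simps = balanced_Nil balanced_Write balanced_Nop balanced_Delete

text \<open>Symbols do not interact: a multiset memory is a family of independent counters, one for
  each symbol.\<close>

lemma mem_run_empty_iff:
  "mem_run P M = Some {#} \<longleftrightarrow> (\<forall>s. balanced s (count M s) P)"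
proof (induction P arbitrary: M)
  case Nil
  show ?case by (auto simp: balanced_simps multiset_eq_iff)
next
  case (Cons a P)
  show ?case
  proof (cases a)
    case (Delete t)
    have "(\<forall>s. balanced s (count M s) (a # P)) \<longleftrightarrow>
        t \<in># M \<and> (\<forall>s. balanced s (count (M - {#t#}) s) P)"
      unfolding Delete balanced_simps by (auto split: if_splits)
    then show ?thesis using Delete Cons.IH by auto
  next
    case (Write t)
    have "balanced s (count M s) (a # P) \<longleftrightarrow> balanced s (count (add_mset t M) s) P" for s
      by (simp add: Write balanced_simps)
    then show ?thesis using Write Cons.IH by simp
  qed (simp add: Cons.IH balanced_simps)
qed

lemma balanced_absent:
  assumes "\<And>a. a \<in> set P \<Longrightarrow> s \<notin> set_memop a"
  shows "balanced s 0 P"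
  using assms
proof (induction P)
  case (Cons a P)
  then have "balanced s 0 P" "s \<notin> set_memop a" by auto
  then show ?case by (cases a) (auto simp: balanced_simps)
qed (simp add: balanced_simps)

text \<open>The multiset tracks every symbol, \<open>realizable\<close> only those in
  \<open>S\<close>; a symbol that no operation mentions is trivially balanced.\<close>

lemma realizable_iff_mem_run:
  assumes "\<And>a. a \<in> set P \<Longrightarrow> set_memop a \<subseteq> S"
  shows "realizable S P \<longleftrightarrow> mem_run P {#} = Some {#}"
  using assms balanced_absent[of P] by (fastforce simp: realizable_iff_balanced mem_run_empty_iff)

section \<open>Weighted walks to the sink as functions of the memory\<close>

definition rabp_walks :: "('v, 's, 'x, 'a) rabp \<Rightarrow> 'v \<Rightarrow> ('v \<times> 'v) list set" where
  "rabp_walks G u = {P. pre_digraph.awalk (with_proj (rabp_graph G)) u P (rabp_sink G)}"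

definition walk_sum ::
  "('v, 's, 'x, 'a::comm_ring_1) rabp \<Rightarrow> 'v \<Rightarrow> 's multiset \<Rightarrow> ('x, 'a) mpoly" where
  "walk_sum G u M = (\<Sum>P\<in>rabp_walks G u.
     if mem_run (map (rabp_op G) P) M = Some {#} then rabp_path_weight G P else 0)"

text \<open>Prepends an edge to all walks that \<open>K\<close> summarizes: \<open>K\<close> is the
  behaviour of the head of the edge, as a function of the memory on arrival there.\<close>

definition op_apply ::
  "('x, 'a::comm_ring_1) input \<Rightarrow> 's memop \<Rightarrow> ('s multiset \<Rightarrow> ('x, 'a) mpoly) \<Rightarrow> 's multiset \<Rightarrow> ('x, 'a) mpoly"
  where
  "op_apply w a K M = input_poly w * (case mem_step a M of None \<Rightarrow> 0 | Some M' \<Rightarrow> K M')"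

locale rabp =
  fixes G :: "('v, 's, 'x, 'a::comm_ring_1) rabp"
  assumes is_rabp: "is_rabp G"
begin

sublocale pair_fin_digraph "rabp_graph G"
  using is_rabp by (simp add: is_rabp_def)

abbreviation "E \<equiv> parcs (rabp_graph G)"
abbreviation "V \<equiv> pverts (rabp_graph G)"

lemma acyclic_E: "acyclic E"
  using is_rabp by (simp add: is_rabp_def)

lemma awalk_trancl: "awalk u P v \<Longrightarrow> P \<noteq> [] \<Longrightarrow> (u, v) \<in> E\<^sup>+"
proof (induction P arbitrary: u)
  case (Cons e P)
  then have e: "e \<in> E" "u = fst e" "awalk (snd e) P v" by (auto simp: awalk_Cons_iff)
  show ?case
  proof (cases "P = []")
    case True
    then show ?thesis using e by (cases e) (auto simp: awalk_Nil_iff)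
  next
    case False
    then have "(snd e, v) \<in> E\<^sup>+" using Cons.IH e by simp
    then show ?thesis using e by (metis prod.collapse trancl_into_trancl2)
  qed
qed simp

lemma awalk_distinct: "awalk u P v \<Longrightarrow> distinct (awalk_verts u P)"
proof (induction P arbitrary: u)
  case (Cons e P)
  then have e: "e \<in> E" "u = fst e" "awalk (snd e) P v" by (auto simp: awalk_Cons_iff)
  have "u \<notin> set (awalk_verts (snd e) P)"
  proof
    assume "u \<in> set (awalk_verts (snd e) P)"
    then obtain q where "awalk (snd e) q u"
      using awalk_decomp[OF e(3)] by blast
    then have "(snd e, u) \<in> E\<^sup>*"
      using awalk_trancl[of "snd e" q u] by (cases "q = []") (auto simp: awalk_Nil_iff)
    then have "(u, u) \<in> E\<^sup>+" using e by (metis prod.collapse rtrancl_into_trancl2)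
    then show False using acyclic_E by (simp add: acyclic_def)
  qed
  then show ?case using Cons.IH[OF e(3)] by (simp add: e(2))
qed simp

text \<open>A repeated vertex would close a cycle. Walks are preferable to paths because their first
  edge can be removed without a distinctness condition.\<close>

lemma apath_iff_awalk: "apath u P v \<longleftrightarrow> awalk u P v"
  using awalk_distinct by (auto simp: apath_def)

lemma finite_walks: "finite (rabp_walks G u)"
  using apaths_finite[of u "rabp_sink G"] by (simp add: rabp_walks_def apath_iff_awalk)

lemma walks_sink: "rabp_walks G (rabp_sink G) = {[]}"
proof -
  have "P = []" if "awalk (rabp_sink G) P (rabp_sink G)" for P
    using awalk_trancl[OF that] acyclic_E by (auto simp: acyclic_def)
  moreover have "rabp_sink G \<in> V" using is_rabp by (simp add: is_rabp_def)
  ultimately show ?thesis by (auto simp: rabp_walks_def awalk_Nil_iff)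
qed

lemma walks_unfold:
  assumes "u \<noteq> rabp_sink G"
  shows "rabp_walks G u = (\<Union>v\<in>{v. (u, v) \<in> E}. (#) (u, v) ` rabp_walks G v)"
proof (rule set_eqI)
  fix P show "P \<in> rabp_walks G u \<longleftrightarrow> P \<in> (\<Union>v\<in>{v. (u, v) \<in> E}. (#) (u, v) ` rabp_walks G v)"
    using assms by (cases P) (auto simp: rabp_walks_def awalk_Nil_iff awalk_Cons_iff)
qed

lemma finite_succs: "finite {v. (u, v) \<in> E}"
  by (rule finite_subset[of _ "snd ` E"]) (force simp: pair_finite_arcs)+

lemma walk_sum_sink: "walk_sum G (rabp_sink G) M = (if M = {#} then 1 else 0)"
  by (simp add: walk_sum_def walks_sink rabp_path_weight_def)

lemma walk_sum_unfold:
  assumes "u \<noteq> rabp_sink G"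
  shows "walk_sum G u M =
    (\<Sum>v | (u, v) \<in> E. op_apply (rabp_weight G (u, v)) (rabp_op G (u, v)) (walk_sum G v) M)"
proof -
  let ?t = "\<lambda>M P. if mem_run (map (rabp_op G) P) M = Some {#} then rabp_path_weight G P else 0"
  have "walk_sum G u M = (\<Sum>v | (u, v) \<in> E. \<Sum>P\<in>(#) (u, v) ` rabp_walks G v. ?t M P)"
    unfolding walk_sum_def walks_unfold[OF assms]
    by (rule sum.UNION_disjoint) (auto simp: finite_succs finite_walks)
  also have "\<dots> = (\<Sum>v | (u, v) \<in> E. op_apply (rabp_weight G (u, v)) (rabp_op G (u, v)) (walk_sum G v) M)"
  proof (rule sum.cong[OF refl])
    fix v
    have "(\<Sum>P\<in>(#) (u, v) ` rabp_walks G v. ?t M P) = (\<Sum>P\<in>rabp_walks G v. ?t M ((u, v) # P))"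
      by (subst sum.reindex) (auto simp: inj_on_def)
    also have "\<dots> = op_apply (rabp_weight G (u, v)) (rabp_op G (u, v)) (walk_sum G v) M"
      by (auto simp: op_apply_def walk_sum_def rabp_path_weight_def sum_distrib_left
          intro!: sum.cong split: option.splits)
    finally show "(\<Sum>P\<in>(#) (u, v) ` rabp_walks G v. ?t M P) =
      op_apply (rabp_weight G (u, v)) (rabp_op G (u, v)) (walk_sum G v) M" .
  qed
  finally show ?thesis .
qed

lemma computes_iff: "rabp_computes G f \<longleftrightarrow> f = walk_sum G (rabp_source G) {#}"
proof -
  have "realizable (rabp_symbols G) (map (rabp_op G) P) \<longleftrightarrow> mem_run (map (rabp_op G) P) {#} = Some {#}"
    if "P \<in> rabp_walks G u" for u P
  proof (rule realizable_iff_mem_run)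
    fix a assume "a \<in> set (map (rabp_op G) P)"
    then obtain e where "e \<in> set P" "a = rabp_op G e" by auto
    moreover have "set P \<subseteq> E" using that by (auto simp: rabp_walks_def awalk_def)
    ultimately show "set_memop a \<subseteq> rabp_symbols G" using is_rabp by (auto simp: is_rabp_def)
  qed
  then have "rabp_realizable_paths G =
      {P \<in> rabp_walks G (rabp_source G). mem_run (map (rabp_op G) P) {#} = Some {#}}"
    by (auto simp: rabp_realizable_paths_def apath_iff_awalk rabp_walks_def)
  then have "(\<Sum>P\<in>rabp_realizable_paths G. rabp_path_weight G P) = walk_sum G (rabp_source G) {#}"
    by (simp add: walk_sum_def sum.inter_filter finite_walks)
  then show ?thesis using is_rabp by (simp add: rabp_computes_def)
qed

end

section \<open>Branching programs as derivations\<close>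

text \<open>A vertex is represented by its behaviour, the function \<open>walk_sum\<close> from
  memories to polynomials. \<open>bp_branch\<close> asks for two different behaviours because the
  graph has no parallel edges: equal behaviours might belong to a single vertex.\<close>

inductive bp_step :: "('s multiset \<Rightarrow> ('x, 'a::comm_ring_1) mpoly) set \<Rightarrow>
    ('s multiset \<Rightarrow> ('x, 'a) mpoly) \<Rightarrow> bool"
  for A where
  bp_op: "K \<in> A \<Longrightarrow> bp_step A (op_apply w a K)"
| bp_branch: "K \<in> A \<Longrightarrow> L \<in> A \<Longrightarrow> K \<noteq> L \<Longrightarrow> bp_step A (\<lambda>M. K M + L M)"

interpretation bp: dag_steps bp_step
  by unfold_locales (auto elim!: bp_step.cases intro: bp_step.intros)

definition sink_value :: "'s multiset \<Rightarrow> ('x, 'a::comm_ring_1) mpoly" where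
  "sink_value M = (if M = {#} then 1 else 0)"

lemma op_apply_Nop: "op_apply w Nop K = (\<lambda>M. input_poly w * K M)"
  by (simp add: op_apply_def fun_eq_iff)

lemma bp_add:
  assumes "K \<in> A" "L \<in> A"
  shows "dag bp_step A 1 {\<lambda>M. K M + L M}"
proof (rule bp.dag_step, cases "K = L")
  case True
  \<comment> \<open>Two parallel edges to \<open>K\<close> are merged into one of weight
    \<open>1 + 1\<close>, which is correct in every characteristic.\<close>
  have "op_apply (Constant (1 + 1)) Nop K = (\<lambda>M. K M + L M)"
    by (simp only: op_apply_Nop input_poly.simps mp_const_add mp_const_1 distrib_right True mult_1)
  then show "bp_step A (\<lambda>M. K M + L M)" using bp_op[OF assms(1)] by metis
next
  case False
  then show "bp_step A (\<lambda>M. K M + L M)" using assms by (rule bp_branch[rotated 2])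
qed

text \<open>List positions become vertices, with the sink prepended at position 0, which accounts
  for the \<open>Suc\<close>. Edges lead to smaller positions, so the graph is acyclic and
  \<open>walk_sum_unfold\<close> recovers the listed functions by induction.\<close>

lemma bp_dag_rabp:
  fixes K :: "'s multiset \<Rightarrow> ('x, 'a::comm_ring_1) mpoly"
  assumes "dag bp_step {sink_value} n {K}"
  obtains G :: "(nat, 's, 'x, 'a) rabp"
  where "rabp_computes G (K {#})" "rabp_size G \<le> Suc n"
proof -
  obtain xs where xs: "length xs \<le> n" "K \<in> set (sink_value # xs)"
    "\<And>i. i < length xs \<Longrightarrow> bp_step ({sink_value} \<union> set (take i xs)) (xs ! i)"
    using assms unfolding dag_def by auto
  define ys where "ys = sink_value # xs"
  have step: "bp_step (set (take i ys)) (ys ! i)" if "0 < i" "i < length ys" for i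
    using that xs(3) by (cases i) (auto simp: ys_def)
  \<comment> \<open>\<open>D\<close> lists the outgoing edges of vertex \<open>i\<close> as a
    partial map from heads to labels, so each head gets at most one edge.\<close>
  let ?P = "\<lambda>i D. (\<forall>j\<in>dom D. j < i) \<and>
      ys ! i = (\<lambda>M. \<Sum>j\<in>dom D. op_apply (fst (the (D j))) (snd (the (D j))) (ys ! j) M)"
  have "\<exists>D. ?P i D" if "0 < i" "i < length ys" for i
    using step[OF that]
  proof cases
    case (bp_op L w a)
    then obtain j where "j < i" "L = ys ! j" using in_set_takeD_nth by metis
    then show ?thesis using bp_op by (intro exI[of _ "[j \<mapsto> (w, a)]"]) simp
  next
    case (bp_branch L L')
    then obtain j k where jk: "j < i" "L = ys ! j" "k < i" "L' = ys ! k"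
      using in_set_takeD_nth by metis
    then have "j \<noteq> k" using bp_branch by auto
    then show ?thesis using bp_branch jk
      by (intro exI[of _ "[j \<mapsto> (Constant 1, Nop), k \<mapsto> (Constant 1, Nop)]"])
        (simp add: op_apply_Nop add.commute)
  qed
  then have "\<forall>i\<in>{0<..<length ys}. \<exists>D. ?P i D" by simp
  from bchoice[OF this] obtain D where P: "\<forall>i\<in>{0<..<length ys}. ?P i (D i)" by (rule exE)
  have D: "\<And>i j. 0 < i \<Longrightarrow> i < length ys \<Longrightarrow> j \<in> dom (D i) \<Longrightarrow> j < i"
    "\<And>i. 0 < i \<Longrightarrow> i < length ys \<Longrightarrow>
      ys ! i = (\<lambda>M. \<Sum>j\<in>dom (D i). op_apply (fst (the (D i j))) (snd (the (D i j))) (ys ! j) M)"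
    using P by simp_all
  obtain k where k: "k < length ys" "K = ys ! k" 
    using xs(2) unfolding ys_def[symmetric] in_set_conv_nth by blast
  define E where "E = {(i, j). 0 < i \<and> i < length ys \<and> j \<in> dom (D i)}"
  define G :: "(nat, 's, 'x, 'a) rabp" where
    "G = \<lparr>rabp_graph = \<lparr>pverts = {..<length ys}, parcs = E\<rparr>, rabp_source = k, rabp_sink = 0,
       rabp_weight = (\<lambda>(i, j). fst (the (D i j))),
       rabp_symbols = (\<Union>(i, j)\<in>E. set_memop (snd (the (D i j)))),
       rabp_op = (\<lambda>(i, j). snd (the (D i j)))\<rparr>"
  have E: "E \<subseteq> less_than\<inverse> \<inter> {..<length ys} \<times> {..<length ys}"
  proof (rule subrelI)
    fix i j assume "(i, j) \<in> E"
    then have "0 < i" "i < length ys" "j \<in> dom (D i)" by (simp_all only: E_def mem_Collect_eq prod.case)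
    moreover from D(1)[OF this] have "j < i" .
    ultimately show "(i, j) \<in> less_than\<inverse> \<inter> {..<length ys} \<times> {..<length ys}" by simp
  qed
  then have "E \<subseteq> {..<length ys} \<times> {..<length ys}" by blast
  then have "finite E" by (rule finite_subset) simp
  have "acyclic (less_than\<inverse>)" by (simp add: wf_acyclic)
  then have "acyclic E" by (rule acyclic_subset) (use E in blast)
  have "pair_fin_digraph \<lparr>pverts = {..<length ys}, parcs = E\<rparr>"
    by unfold_locales (use E \<open>finite E\<close> in auto)
  moreover have "finite (set_memop a)" for a :: "'s memop" by (cases a) auto
  ultimately have "is_rabp G"
    using k \<open>finite E\<close> \<open>acyclic E\<close> by (auto simp: is_rabp_def G_def)
  then interpret rabp G by (rule rabp.intro)
  have "walk_sum G i = ys ! i" if "i < length ys" for i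
    using that
  proof (induction i rule: less_induct)
    case (less i)
    show ?case
    proof (cases "i = 0")
      case True
      then show ?thesis
        using walk_sum_sink by (simp add: fun_eq_iff ys_def G_def sink_value_def)
    next
      case False
      have "{v. (i, v) \<in> parcs (rabp_graph G)} = dom (D i)"
        using False less.prems by (auto simp: G_def E_def)
      moreover have "walk_sum G j = ys ! j" if "j \<in> dom (D i)" for j
        using D(1)[OF _ less.prems that] False less by auto
      ultimately have "walk_sum G i M = (ys ! i) M" for M
        using False less.prems
        by (subst walk_sum_unfold) (auto simp: D(2) G_def intro!: sum.cong)
      then show ?thesis by (simp add: fun_eq_iff)
    qed
  qed
  then have "rabp_computes G (K {#})"
    using k by (simp add: computes_iff) (simp add: G_def)
  moreover have "rabp_size G \<le> Suc n"
    using xs(1) by (simp add: rabp_size_def G_def ys_def)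
  ultimately show thesis by (rule that)
qed

section \<open>Weighted rewriting rules and loops over the copies of a symbol\<close>

definition rules_apply ::
  "(('x, 'a::comm_ring_1) input \<times> 's list) list \<Rightarrow> ('s multiset \<Rightarrow> ('x, 'a) mpoly) \<Rightarrow> 's multiset \<Rightarrow> ('x, 'a) mpoly"
  where "rules_apply rs K M = (\<Sum>(w, ss)\<leftarrow>rs. input_poly w * K (M + mset ss))"

lemma bp_writes:
  assumes "K \<in> A"
  shows "dag bp_step A (length ss) {\<lambda>M. K (M + mset ss)}"
proof (induction ss)
  case Nil
  show ?case using assms by (intro bp.dag_refl) simp
next
  case (Cons s ss)
  have "op_apply (Constant 1) (Write s) (\<lambda>M. K (M + mset ss)) = (\<lambda>M. K (M + mset (s # ss)))"
    by (simp add: op_apply_def fun_eq_iff)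
  moreover have "bp_step (A \<union> {\<lambda>M. K (M + mset ss)})
      (op_apply (Constant 1) (Write s) (\<lambda>M. K (M + mset ss)))"
    by (rule bp_op) simp
  ultimately show ?case using bp.dag_then_step[OF Cons.IH] by simp
qed

text \<open>Per rule at most two writes, one edge carrying the weight, and one branching; the extra
  vertex is the empty sum.\<close>

lemma bp_rules:
  assumes "K \<in> A" "\<And>w ss. (w, ss) \<in> set rs \<Longrightarrow> length ss \<le> 2"
  shows "dag bp_step A (4 * length rs + 1) {rules_apply rs K}"
  using assms(2)
proof (induction rs)
  case Nil
  have "bp_step A (op_apply (Constant 0) Nop K)" using assms(1) by (rule bp_op)
  moreover have "op_apply (Constant 0) Nop K = rules_apply [] K"
    by (simp add: op_apply_Nop rules_apply_def fun_eq_iff)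
  ultimately show ?case using bp.dag_step by fastforce
next
  case (Cons r rs)
  obtain w ss where r: "r = (w, ss)" by force
  let ?K = "\<lambda>M. K (M + mset ss)"
  have "bp_step (A \<union> {?K}) (op_apply w Nop ?K)" by (rule bp_op) simp
  with bp_writes[OF assms(1)] have "dag bp_step A (Suc (length ss)) {op_apply w Nop ?K}"
    by (rule bp.dag_then_step)
  then have "dag bp_step A 3 {op_apply w Nop ?K}"
    using Cons.prems[of w ss] by (elim bp.dag_weaken) (auto simp: r)
  moreover have "dag bp_step A (4 * length rs + 1) {rules_apply rs K}"
    using Cons by auto
  ultimately have "dag bp_step A (3 + (4 * length rs + 1))
      ({op_apply w Nop ?K} \<union> {rules_apply rs K})"
    by (rule bp.dag_Un)
  moreover have "dag bp_step (A \<union> ({op_apply w Nop ?K} \<union> {rules_apply rs K})) 1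
      {\<lambda>M. op_apply w Nop ?K M + rules_apply rs K M}"
    by (rule bp_add) simp_all
  ultimately have "dag bp_step A (3 + (4 * length rs + 1) + 1)
      {\<lambda>M. op_apply w Nop ?K M + rules_apply rs K M}"
    by (rule bp.dag_then)
  moreover have "(\<lambda>M. op_apply w Nop ?K M + rules_apply rs K M) = rules_apply (r # rs) K"
    by (simp add: fun_eq_iff r rules_apply_def op_apply_Nop)
  ultimately show ?case by simp
qed

primrec rewrite_loop ::
  "'s \<Rightarrow> (('x, 'a::comm_ring_1) input \<times> 's list) list \<Rightarrow> ('s multiset \<Rightarrow> ('x, 'a) mpoly) \<Rightarrow> nat \<Rightarrow>
     's multiset \<Rightarrow> ('x, 'a) mpoly" where
  "rewrite_loop t rs K 0 = K"
| "rewrite_loop t rs K (Suc r) =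
     (\<lambda>M. K M + op_apply (Constant 1) (Delete t) (rules_apply rs (rewrite_loop t rs K r)) M)"

text \<open>A round consists of the rules (\<open>4 * length rs + 1\<close>), the deletion of
  \<open>t\<close>, and the choice between leaving and continuing.\<close>

lemma bp_rewrite_loop:
  assumes "K \<in> A" "\<And>w ss. (w, ss) \<in> set rs \<Longrightarrow> length ss \<le> 2"
  shows "dag bp_step A (r * (4 * length rs + 3)) {rewrite_loop t rs K r}"
proof (induction r)
  case 0
  show ?case using assms(1) by (intro bp.dag_refl) simp
next
  case (Suc r)
  let ?L = "rewrite_loop t rs K r"
  let ?R = "rules_apply rs ?L" and ?O = "op_apply (Constant 1) (Delete t) (rules_apply rs ?L)"
  have "dag bp_step (A \<union> {?L}) (4 * length rs + 1) {?R}"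
    by (rule bp_rules) (use assms(2) in auto)
  then have "dag bp_step (A \<union> {?L}) (Suc (4 * length rs + 1)) {?O}"
    by (rule bp.dag_then_step) (rule bp_op, simp)
  moreover have "dag bp_step (A \<union> {?L} \<union> {?O}) 1 {rewrite_loop t rs K (Suc r)}"
    unfolding rewrite_loop.simps by (rule bp_add) (use assms(1) in simp_all)
  ultimately have "dag bp_step (A \<union> {?L}) (Suc (4 * length rs + 1) + 1) {rewrite_loop t rs K (Suc r)}"
    by (rule bp.dag_then)
  from bp.dag_then[OF Suc.IH this]
  show ?case by (rule bp.dag_weaken) (simp_all del: rewrite_loop.simps)
qed

text \<open>As long as \<open>t\<close> is present, \<open>K\<close> vanishes, so that exactly the branch which applies the loop body
  \<open>count M t\<close> times contributes.\<close>

lemma rewrite_loop_eq: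
  assumes "\<And>M. good M \<Longrightarrow> K M = (if t \<in># M then 0 else H M)"
    and "\<And>M. good M \<Longrightarrow> t \<in># M \<Longrightarrow> H M = rules_apply rs H (M - {#t#})"
    and "\<And>M w ss. good M \<Longrightarrow> t \<in># M \<Longrightarrow> (w, ss) \<in> set rs \<Longrightarrow>
       good (M - {#t#} + mset ss) \<and> t \<notin> set ss"
    and "good M" "count M t \<le> r"
  shows "rewrite_loop t rs K r M = H M"
  using assms(4,5)
proof (induction r arbitrary: M)
  case 0
  then have "t \<notin># M" by (simp add: not_in_iff)
  then show ?case using assms(1)[OF 0(1)] by simp
next
  case (Suc r)
  show ?case
  proof (cases "t \<in># M")
    case False
    then show ?thesis using assms(1)[OF Suc.prems(1)] by (simp add: op_apply_def)
  next
    case True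
    have "rewrite_loop t rs K r (M - {#t#} + mset ss) = H (M - {#t#} + mset ss)"
      if "(w, ss) \<in> set rs" for w ss
    proof (rule Suc.IH)
      show "good (M - {#t#} + mset ss)" using assms(3)[OF Suc.prems(1) True that] by simp
      \<comment> \<open>No rule writes \<open>t\<close> again, so each round lowers its count by one
        and \<open>r\<close> rounds suffice.\<close>
      have no_t: "count (mset ss) t = 0"
        using assms(3)[OF Suc.prems(1) True that] by simp
      show "count (M - {#t#} + mset ss) t \<le> r"
        using Suc.prems(2) True unfolding count_union no_t by simp
    qed
    then have "rules_apply rs (rewrite_loop t rs K r) (M - {#t#}) = rules_apply rs H (M - {#t#})"
      unfolding rules_apply_def by (intro arg_cong[of _ _ sum_list] map_cong) auto
    then show ?thesis
      using True assms(1,2)[OF Suc.prems(1)] by (simp add: op_apply_def)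
  qed
qed

section \<open>From circuits to branching programs\<close>

lemma grading_add: "grading \<theta> (f + g) = grading \<theta> f + grading \<theta> g"
  and grading_mult: "grading \<theta> (f * g) = grading \<theta> f * grading \<theta> g"
  and grading_const: "grading \<theta> (mp_const c) = [:mp_const c:]"
  and grading_var: "grading \<theta> (mp_var x) = monom (\<theta> x) 1"
  by (simp_all add: grading_def)

lemma sum_list_sum_swap:
  fixes F :: "'b \<Rightarrow> 'c \<Rightarrow> 'd::comm_ring_1"
  shows "(\<Sum>x\<leftarrow>xs. \<Sum>e\<in>A. F x e * h e) = (\<Sum>e\<in>A. (\<Sum>x\<leftarrow>xs. F x e) * h e)"
  by (induction xs) (simp_all add: sum.distrib distrib_right)

definition assign :: "(nat \<Rightarrow> 'a::comm_ring_1) \<Rightarrow> nat + nat \<Rightarrow> (nat, 'a) mpoly" where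
  "assign e = case_sum (\<lambda>i. mp_const (e i)) mp_var"

locale boolean_sum_circuit =
  fixes C :: "(nat, nat + nat, 'a::field) circuit" and D p :: nat
  assumes circuit: "is_circuit C"
begin

definition gate_poly :: "nat \<Rightarrow> (nat + nat, 'a) mpoly" where
  "gate_poly v = (THE f. gate_computes C v f)"

lemma gate_poly_eq: "gate_computes C v f \<Longrightarrow> gate_poly v = f"
  unfolding gate_poly_def by (rule the_equality) (auto dest: gate_computes_unique)

lemma gate_poly:
  assumes "v \<in> gates C"
  shows "gate_computes C v (gate_poly v)"
proof -
  obtain f where f: "gate_computes C v f" using gate_computes_exists[OF circuit assms] by (rule exE)
  then show ?thesis by (simp only: gate_poly_eq)
qed

lemma pred_in_gates: "v \<in> gates C \<Longrightarrow> u \<in> predecessors (gate_label C v) \<Longrightarrow> u \<in> gates C"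
  using circuit by (auto simp: is_circuit_def circuit_edges_def)

lemma gate_poly_Input: "v \<in> gates C \<Longrightarrow> gate_label C v = Input x \<Longrightarrow> gate_poly v = input_poly x"
  by (intro gate_poly_eq gate_computes.intros)

lemma gate_poly_Plus:
  assumes "v \<in> gates C" "gate_label C v = Plus u w"
  shows "gate_poly v = gate_poly u + gate_poly w"
proof -
  have "u \<in> gates C" "w \<in> gates C"
    using pred_in_gates[OF assms(1)] by (simp_all add: assms(2))
  then show ?thesis by (intro gate_poly_eq gate_computes.intros(2)[OF assms(2)] gate_poly)
qed

lemma gate_poly_Times:
  assumes "v \<in> gates C" "gate_label C v = Times u w"
  shows "gate_poly v = gate_poly u * gate_poly w"
proof -
  have "u \<in> gates C" "w \<in> gates C"
    using pred_in_gates[OF assms(1)] by (simp_all add: assms(2))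
  then show ?thesis by (intro gate_poly_eq gate_computes.intros(3)[OF assms(2)] gate_poly)
qed

text \<open>The symbol \<open>tok v i\<close> stands for a factor that is the homogeneous component of degree \<open>i\<close> of gate
  \<open>v\<close>, and \<open>bit k\<close> for a factor that is the \<open>k\<close>-th Boolean variable.\<close>

definition tok :: "nat \<Rightarrow> nat \<Rightarrow> nat" where
  "tok v i = to_nat (Inl (v, i) :: nat \<times> nat + nat)"

definition bit :: "nat \<Rightarrow> nat" where
  "bit k = to_nat (Inr k :: nat \<times> nat + nat)"

lemma tok_eq_iff [simp]: "tok v i = tok w j \<longleftrightarrow> v = w \<and> i = j"
  and bit_eq_iff [simp]: "bit k = bit l \<longleftrightarrow> k = l"
  and tok_neq_bit [simp]: "tok v i \<noteq> bit k" "bit k \<noteq> tok v i"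
  by (simp_all add: tok_def bit_def)

definition sym_value :: "(nat \<Rightarrow> 'a) \<Rightarrow> nat \<Rightarrow> (nat, 'a) mpoly" where
  "sym_value e s = (case from_nat s :: nat \<times> nat + nat of
     Inl (v, i) \<Rightarrow> coeff (grading (assign e) (gate_poly v)) i | Inr k \<Rightarrow> mp_const (e k))"

text \<open>A Boolean variable counts as degree 1 because it replaces a symbol of degree 1; thus
  rewriting never raises the total degree.\<close>

definition sym_degree :: "nat \<Rightarrow> nat" where
  "sym_degree s = (case from_nat s :: nat \<times> nat + nat of Inl (v, i) \<Rightarrow> i | Inr k \<Rightarrow> 1)"

lemma sym_value_simps [simp]:
  "sym_value e (tok v i) = coeff (grading (assign e) (gate_poly v)) i"
  "sym_value e (bit k) = mp_const (e k)"
  by (simp_all add: sym_value_def tok_def bit_def)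

lemma sym_degree_simps [simp]: "sym_degree (tok v i) = i" "sym_degree (bit k) = 1"
  by (simp_all add: sym_degree_def tok_def bit_def)

definition good :: "nat multiset \<Rightarrow> bool" where
  "good M \<longleftrightarrow> (\<Sum>s\<in>#M. sym_degree s) \<le> D \<and> (\<forall>s\<in>#M. sym_degree s > 0)"

text \<open>Since all degrees in a good memory are positive, its size is at most its total degree.
  This is where \<open>D\<close> comes from as the number of loop rounds.\<close>

lemma good_count:
  assumes "good M"
  shows "count M t \<le> D"
proof -
  have "size M \<le> (\<Sum>s\<in>#M. sym_degree s)" if "\<forall>s\<in>#M. sym_degree s > 0"
    using that
  proof (induction M)
    case (add s M)
    then have "sym_degree s > 0" "size M \<le> (\<Sum>s\<in>#M. sym_degree s)" by simp_all
    then show ?case by simp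
  qed simp
  moreover have "count M t \<le> size M" by (rule count_le_size)
  ultimately show ?thesis using assms unfolding good_def by linarith
qed

definition assignments :: "(nat \<Rightarrow> 'a) set" where
  "assignments = {..<p} \<rightarrow>\<^sub>E {0, 1}"

text \<open>The specification of a program that can dispose of exactly the symbols in
  \<open>T\<close>: a memory with any other symbol can never be emptied, whence the value 0.\<close>

definition value_on :: "nat set \<Rightarrow> nat multiset \<Rightarrow> (nat, 'a) mpoly" where
  "value_on T M =
     (if set_mset M \<subseteq> T then \<Sum>e\<in>assignments. \<Prod>s\<in>#M. sym_value e s else 0)"

section \<open>Summing over the Boolean variables\<close>

definition bit_value :: "nat \<Rightarrow> nat multiset \<Rightarrow> (nat, 'a) mpoly" where
  "bit_value k M =
     (if set_mset M \<subseteq> bit ` {..<k} then \<Prod>i<k. if bit i \<in># M then 1 else 2 else 0)"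

text \<open>The summands are the two values of variable \<open>k\<close>. For 0 no copy may be
  present, and \<open>bit_value k\<close> indeed vanishes if there is one; for 1 all copies are
  erased.\<close>

lemma bit_value_Suc:
  "bit_value (Suc k) M = bit_value k M + bit_value k (filter_mset (\<lambda>s. s \<noteq> bit k) M)"
proof -
  let ?N = "filter_mset (\<lambda>s. s \<noteq> bit k) M"
  have sub: "set_mset ?N \<subseteq> bit ` {..<k} \<longleftrightarrow> set_mset M \<subseteq> bit ` {..<Suc k}"
    by (auto simp: lessThan_Suc)
  have prod: "(\<Prod>i<k. if bit i \<in># ?N then 1 else 2 :: (nat, 'a) mpoly) =
      (\<Prod>i<k. if bit i \<in># M then 1 else 2)"
    by (rule prod.cong) auto
  show ?thesis
  proof (cases "bit k \<in># M")
    case True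
    then have "\<not> set_mset M \<subseteq> bit ` {..<k}" by auto
    then show ?thesis using True by (simp only: bit_value_def sub prod) simp
  next
    case False
    then have "?N = M" by (auto simp: filter_mset_eq_conv)
    then show ?thesis using False sub by (auto simp: bit_value_def)
  qed
qed

text \<open>Each variable costs \<open>D\<close> rounds of a loop with one rule, 7 vertices a round,
  and one branching vertex.\<close>

lemma bit_stage:
  assumes "k \<le> p"
  shows "\<exists>K. dag bp_step {sink_value} (k * (7 * D + 1)) {K} \<and> (\<forall>M. good M \<longrightarrow> K M = bit_value k M)"
  using assms
proof (induction k)
  case 0
  have "dag bp_step {sink_value} (0 * (7 * D + 1)) {sink_value}" by (rule bp.dag_refl) simp
  moreover have "sink_value M = bit_value 0 M" for M
    by (auto simp: sink_value_def bit_value_def)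
  ultimately show ?case by blast
next
  case (Suc k)
  then obtain K where K: "dag bp_step {sink_value} (k * (7 * D + 1)) {K}"
    "\<And>M. good M \<Longrightarrow> K M = bit_value k M" by auto
  \<comment> \<open>The only rule writes nothing, so the loop \<open>L\<close> erases the copies of
    \<open>bit k\<close> (value 1), whereas \<open>K\<close> alone tolerates none (value 0).\<close>
  define rs :: "((nat, 'a) input \<times> nat list) list" where "rs = [(Constant 1, [])]"
  define L where "L = rewrite_loop (bit k) rs K D"
  have "dag bp_step ({sink_value} \<union> {K}) (D * (4 * length rs + 3)) {L}"
    unfolding L_def by (rule bp_rewrite_loop) (auto simp: rs_def)
  moreover have "dag bp_step ({sink_value} \<union> {K} \<union> {L}) 1 {\<lambda>M. K M + L M}"
    by (rule bp_add) auto
  ultimately have "dag bp_step ({sink_value} \<union> {K}) (D * (4 * length rs + 3) + 1) {\<lambda>M. K M + L M}"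
    by (rule bp.dag_then)
  from bp.dag_then[OF K(1) this]
  have "dag bp_step {sink_value} (Suc k * (7 * D + 1)) {\<lambda>M. K M + L M}"
    by (rule bp.dag_weaken) (simp_all add: rs_def)
  moreover have "K M + L M = bit_value (Suc k) M" if "good M" for M
  proof -
    let ?H = "\<lambda>M. bit_value k (filter_mset (\<lambda>s. s \<noteq> bit k) M)"
    have "L M = ?H M"
      unfolding L_def
    proof (rule rewrite_loop_eq[where good = good])
      fix M assume M: "good M"
      show "K M = (if bit k \<in># M then 0 else ?H M)"
      proof (cases "bit k \<in># M")
        case True
        then have "\<not> set_mset M \<subseteq> bit ` {..<k}" by auto
        then show ?thesis using True K(2)[OF M] by (simp add: bit_value_def)
      next
        case False
        then have "filter_mset (\<lambda>s. s \<noteq> bit k) M = M" by (auto simp: filter_mset_eq_conv)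
        then show ?thesis using False K(2)[OF M] by simp
      qed
    next
      fix M assume "good M" "bit k \<in># M"
      then show "?H M = rules_apply rs ?H (M - {#bit k#})"
        by (simp add: rules_apply_def rs_def)
    next
      fix M w ss assume M: "good M" "bit k \<in># M" "(w, ss) \<in> set rs"
      then obtain N where "M = add_mset (bit k) N" by (metis insert_DiffM)
      then show "good (M - {#bit k#} + mset ss) \<and> bit k \<notin> set ss"
        using M by (auto simp: rs_def good_def)
    qed (fact that, rule good_count[OF that])
    then show ?thesis using K(2)[OF that] by (simp add: bit_value_Suc)
  qed
  ultimately show ?case by auto
qed

text \<open>Distributivity: the variables are independent, and \<open>0 ^ 0 = 1\<close> makes the
  factor of an absent variable 2.\<close>

lemma sum_assignments_prod:
  "(\<Sum>e\<in>assignments. \<Prod>i<p. mp_const (e i) ^ c i :: (nat, 'a) mpoly) =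
     (\<Prod>i<p. if c i > 0 then 1 else 2)"
proof -
  have "(\<Sum>e\<in>assignments. \<Prod>i<p. mp_const (e i) ^ c i :: (nat, 'a) mpoly) =
      (\<Prod>i<p. \<Sum>b\<in>{0, 1 :: 'a}. mp_const b ^ c i)"
    unfolding assignments_def by (subst prod_sum_PiE) simp_all
  also have "\<dots> = (\<Prod>i<p. if c i > 0 then 1 else 2)"
  proof (rule prod.cong[OF refl])
    fix i
    show "(\<Sum>b\<in>{0, 1 :: 'a}. mp_const b ^ c i :: (nat, 'a) mpoly) = (if c i > 0 then 1 else 2)"
      by (cases "c i = 0") (simp_all add: power_0_left)
  qed
  finally show ?thesis .
qed

lemma bit_value_eq: "bit_value p M = value_on (bit ` {..<p}) M"
proof (cases "set_mset M \<subseteq> bit ` {..<p}")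
  case True
  have "(\<Prod>s\<in>#M. sym_value e s) = (\<Prod>i<p. mp_const (e i) ^ count M (bit i))" for e
    using True
  proof (induction M)
    case (add s M)
    then obtain j where j: "j < p" "s = bit j" by auto
    have "(\<Prod>i<p. mp_const (e i) ^ count (add_mset s M) (bit i)) =
        (\<Prod>i<p. (if i = j then mp_const (e j) else 1) * mp_const (e i) ^ count M (bit i) :: (nat, 'a) mpoly)"
      by (rule prod.cong) (auto simp: j)
    also have "\<dots> = mp_const (e j) * (\<Prod>i<p. mp_const (e i) ^ count M (bit i))"
      using j by (simp add: prod.distrib)
    finally show ?case using add j by simp
  qed simp
  then show ?thesis
    using True by (simp add: value_on_def bit_value_def sum_assignments_prod)
qed (simp add: value_on_def bit_value_def)

section \<open>Expanding the gates\<close>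

definition realizes :: "nat set \<Rightarrow> (nat multiset \<Rightarrow> (nat, 'a) mpoly) \<Rightarrow> bool" where
  "realizes T K \<longleftrightarrow> (\<forall>M. good M \<longrightarrow> K M = value_on T M)"

text \<open>By \<open>val\<close>, replacing one factor \<open>t\<close> by its expansion preserves
  every product, and linearity passes this to the sum over assignments. The rules must be the same
  for all assignments: weights are fixed in the program, while \<open>e\<close> is summed
  over.\<close>

lemma realizes_loop:
  assumes K: "realizes T K" and t: "t \<notin> T"
    and rules: "\<And>w ss. (w, ss) \<in> set rs \<Longrightarrow> set ss \<subseteq> T \<and> sum_list (map sym_degree ss) \<le> sym_degree t \<and>
      (\<forall>s\<in>set ss. sym_degree s > 0)"
    and val: "\<And>e. e \<in> assignments \<Longrightarrow>
      sym_value e t = (\<Sum>(w, ss)\<leftarrow>rs. input_poly w * prod_list (map (sym_value e) ss))"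
  shows "realizes (insert t T) (rewrite_loop t rs K D)"
  unfolding realizes_def
proof (intro allI impI)
  fix M assume "good M"
  show "rewrite_loop t rs K D M = value_on (insert t T) M"
  proof (rule rewrite_loop_eq[where good = good])
    fix M assume M: "good M"
    have KM: "K M = value_on T M" using K M unfolding realizes_def by blast
    show "K M = (if t \<in># M then 0 else value_on (insert t T) M)"
    proof (cases "t \<in># M")
      case True
      then have "\<not> set_mset M \<subseteq> T" using t by auto
      then show ?thesis using True unfolding KM value_on_def by simp
    next
      case False
      then have "set_mset M \<subseteq> T \<longleftrightarrow> set_mset M \<subseteq> insert t T" by auto
      then show ?thesis using False unfolding KM value_on_def by simp
    qed
  next
    fix M assume M: "good M" "t \<in># M"
    then obtain N where N: "M = add_mset t N" by (metis insert_DiffM)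
    show "value_on (insert t T) M = rules_apply rs (value_on (insert t T)) (M - {#t#})"
    proof (cases "set_mset N \<subseteq> insert t T")
      case False
      then have "value_on (insert t T) (N + mset ss) = 0" for ss by (auto simp: value_on_def)
      then have "rules_apply rs (value_on (insert t T)) N = 0"
        by (simp add: rules_apply_def case_prod_unfold)
      then show ?thesis using False N by (simp add: value_on_def)
    next
      case True
      have "rules_apply rs (value_on (insert t T)) N =
          (\<Sum>(w, ss)\<leftarrow>rs. \<Sum>e\<in>assignments. input_poly w * prod_list (map (sym_value e) ss) *
             (\<Prod>s\<in>#N. sym_value e s))"
        unfolding rules_apply_def
      proof (rule arg_cong[where f = sum_list], rule map_cong[OF refl])
        fix r assume r: "r \<in> set rs"
        obtain w ss where w: "r = (w, ss)" by force
        have "set_mset (N + mset ss) \<subseteq> insert t T" using True rules[of w ss] r w by auto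
        moreover have "(\<Prod>s\<in>#mset ss. sym_value e s) = prod_list (map (sym_value e) ss)" for e
          by (simp add: prod_mset_prod_list flip: mset_map)
        ultimately have "input_poly w * value_on (insert t T) (N + mset ss) =
            (\<Sum>e\<in>assignments. input_poly w * prod_list (map (sym_value e) ss) * (\<Prod>s\<in>#N. sym_value e s))"
          by (simp add: value_on_def sum_distrib_left mult_ac)
        then show "(case r of (w, ss) \<Rightarrow> input_poly w * value_on (insert t T) (N + mset ss)) =
            (case r of (w, ss) \<Rightarrow> \<Sum>e\<in>assignments. input_poly w * prod_list (map (sym_value e) ss) *
               (\<Prod>s\<in>#N. sym_value e s))"
          by (simp add: w)
      qed
      also have "\<dots> = (\<Sum>e\<in>assignments. (\<Sum>(w, ss)\<leftarrow>rs. input_poly w * prod_list (map (sym_value e) ss)) *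
             (\<Prod>s\<in>#N. sym_value e s))"
        by (simp add: sum_list_sum_swap case_prod_unfold)
      also have "\<dots> = value_on (insert t T) M"
      proof -
        have "value_on (insert t T) M = (\<Sum>e\<in>assignments. sym_value e t * (\<Prod>s\<in>#N. sym_value e s))"
          using True unfolding value_on_def N by simp
        then show ?thesis by (simp only: val cong: sum.cong)
      qed
      finally show ?thesis by (simp add: N)
    qed
  next
    fix M w ss assume M: "good M" "t \<in># M" "(w, ss) \<in> set rs"
    then obtain N where N: "M = add_mset t N" by (metis insert_DiffM)
    have "(\<Sum>s\<in>#mset ss. sym_degree s) \<le> sym_degree t"
      using rules[OF M(3)] by (simp add: sum_mset_sum_list flip: mset_map)
    moreover have "(\<Sum>s\<in>#M. sym_degree s) = sym_degree t + (\<Sum>s\<in>#N. sym_degree s)"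
      by (simp add: N)
    ultimately have "(\<Sum>s\<in>#N + mset ss. sym_degree s) \<le> D" "\<forall>s\<in>#N + mset ss. sym_degree s > 0"
      using rules[OF M(3)] M(1) by (simp_all add: N good_def ball_Un)
    moreover have "t \<notin> set ss" using rules[OF M(3)] t by blast
    ultimately show "good (M - {#t#} + mset ss) \<and> t \<notin> set ss"
      unfolding good_def N by simp
  qed (fact \<open>good M\<close>, rule good_count[OF \<open>good M\<close>])
qed

text \<open>For a product, the end terms \<open>j = 0\<close> and \<open>j = i\<close> of the
  convolution are separate: there the factor of degree 0 becomes the weight, so only positive
  degrees are written. An index \<open>k\<close> with \<open>\<not> k < p\<close> may occur at a
  gate although it cancels in the output; extensional assignments give it the value
  \<open>undefined\<close>.\<close>

definition gate_rules :: "nat \<Rightarrow> nat \<Rightarrow> ((nat, 'a) input \<times> nat list) list" where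
  "gate_rules v i = (case gate_label C v of
     Input (Constant c) \<Rightarrow> []
   | Input (Variable (Inl k)) \<Rightarrow>
       if i = 1 then [if k < p then (Constant 1, [bit k]) else (Constant undefined, [])] else []
   | Input (Variable (Inr x)) \<Rightarrow> if i = 1 then [(Variable x, [])] else []
   | Plus u w \<Rightarrow> [(Constant 1, [tok u i]), (Constant 1, [tok w i])]
   | Times u w \<Rightarrow>
       (Constant (Poly_Mapping.lookup (gate_poly u) 0), [tok w i]) #
       (Constant (Poly_Mapping.lookup (gate_poly w) 0), [tok u i]) #
       map (\<lambda>j. (Constant 1, [tok u j, tok w (i - j)])) [1..<i])"

lemma gate_rules_value:
  assumes v: "v \<in> gates C" and i: "1 \<le> i" and e: "e \<in> assignments"
  shows "sym_value e (tok v i) =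
    (\<Sum>(w, ss)\<leftarrow>gate_rules v i. input_poly w * prod_list (map (sym_value e) ss))"
proof (cases "gate_label C v")
  case (Input x)
  note poly = gate_poly_Input[OF v Input]
  show ?thesis
  proof (cases x)
    case (Constant c)
    then show ?thesis
      using i poly Input by (simp add: gate_rules_def grading_const coeff_pCons split: nat.split)
  next
    case (Variable y)
    show ?thesis
    proof (cases y)
      case (Inl k)
      have "e k = undefined" if "\<not> k < p"
        using that by (intro PiE_arb[OF e[unfolded assignments_def]]) simp
      then show ?thesis
        using poly Input Variable Inl
        by (simp add: gate_rules_def grading_var assign_def coeff_monom)
    next
      case (Inr z)
      then show ?thesis
        using poly Input Variable by (simp add: gate_rules_def grading_var assign_def coeff_monom)
    qed
  qed
next
  case (Plus u w)
  then show ?thesis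
    using gate_poly_Plus[OF v Plus] by (simp add: gate_rules_def grading_add)
next
  case (Times u w)
  let ?P = "grading (assign e) (gate_poly u)" and ?Q = "grading (assign e) (gate_poly w)"
  have set_eq: "{..i} = insert 0 (insert i {1..<i})" using i by auto
  have "coeff (?P * ?Q) i = coeff ?P 0 * coeff ?Q i + coeff ?P i * coeff ?Q 0 +
      (\<Sum>j\<in>{1..<i}. coeff ?P j * coeff ?Q (i - j))"
    unfolding coeff_mult set_eq using i by (simp add: add.assoc)
  then show ?thesis
    using Times gate_poly_Times[OF v Times]
    by (simp add: gate_rules_def grading_mult grading_coeff_0 o_def interv_sum_list_conv_sum_set_nat
        mult.commute add.assoc)
qed

definition sym_set :: "nat set \<Rightarrow> nat set" where
  "sym_set A = bit ` {..<p} \<union> (\<Union>u\<in>A. tok u ` {1..D})"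

lemma tok_in_sym_set [simp]: "tok u j \<in> sym_set A \<longleftrightarrow> u \<in> A \<and> 1 \<le> j \<and> j \<le> D"
  and bit_in_sym_set [simp]: "bit k \<in> sym_set A \<longleftrightarrow> k < p"
  by (auto simp: sym_set_def image_iff)

lemma gate_rules_symbols:
  assumes r: "(w, ss) \<in> set (gate_rules v i)" and i: "1 \<le> i" "i \<le> D"
    and pred: "predecessors (gate_label C v) \<subseteq> A"
  shows "set ss \<subseteq> sym_set A \<and> sum_list (map sym_degree ss) \<le> i \<and> (\<forall>s\<in>set ss. sym_degree s > 0) \<and>
    length ss \<le> 2"
proof (cases "gate_label C v")
  case (Input x)
  show ?thesis
  proof (cases x)
    case (Constant c)
    then show ?thesis using r Input by (simp add: gate_rules_def)
  next
    case (Variable y)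
    then show ?thesis
      using r Input i by (cases y) (auto simp: gate_rules_def split: if_splits)
  qed
next
  case (Plus a b)
  then have "a \<in> A" "b \<in> A" using pred by simp_all
  then show ?thesis using r Plus i by (auto simp: gate_rules_def)
next
  case (Times a b)
  then have "a \<in> A" "b \<in> A" using pred by simp_all
  then show ?thesis using r Times i
    by (auto simp: gate_rules_def Suc_le_eq intro: order_trans[OF diff_le_self])
qed

lemma length_gate_rules: "1 \<le> i \<Longrightarrow> i \<le> D \<Longrightarrow> length (gate_rules v i) \<le> D + 1"
  by (auto simp: gate_rules_def split: gate.split input.split sum.split)

text \<open>A product has at most \<open>D + 1\<close> rules, so a loop round costs at most
  \<open>4 * (D + 1) + 3 = 4 * D + 7\<close>, and each degree takes \<open>D\<close> rounds.
  Expansions of \<open>v\<close> mention only its predecessors, hence the degrees of one gate do not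
  interfere.\<close>

lemma gate_stage:
  assumes K: "realizes (sym_set A) K" and v: "v \<in> gates C" "v \<notin> A"
    and pred: "predecessors (gate_label C v) \<subseteq> A" and j: "j \<le> D"
  shows "\<exists>L. dag bp_step {K} (j * (D * (4 * D + 7))) {L} \<and> realizes (sym_set A \<union> tok v ` {1..j}) L"
  using j
proof (induction j)
  case 0
  have "dag bp_step {K} (0 * (D * (4 * D + 7))) {K}" by (rule bp.dag_refl) simp
  then show ?case using K by auto
next
  case (Suc j)
  then obtain L where L: "dag bp_step {K} (j * (D * (4 * D + 7))) {L}"
    "realizes (sym_set A \<union> tok v ` {1..j}) L" by auto
  let ?t = "tok v (Suc j)" and ?rs = "gate_rules v (Suc j)"
  let ?L = "rewrite_loop ?t ?rs L D"
  have i: "1 \<le> Suc j" by simp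
  note rules = gate_rules_symbols[OF _ i Suc.prems pred]
  have "dag bp_step ({K} \<union> {L}) (D * (4 * length ?rs + 3)) {?L}"
    by (rule bp_rewrite_loop) (use rules in blast)+
  then have "dag bp_step ({K} \<union> {L}) (D * (4 * D + 7)) {?L}"
    by (rule bp.dag_weaken) (use length_gate_rules[OF i Suc.prems, of v] in simp_all)
  with L(1) have "dag bp_step {K} (j * (D * (4 * D + 7)) + D * (4 * D + 7)) {?L}"
    by (rule bp.dag_then)
  then have "dag bp_step {K} (Suc j * (D * (4 * D + 7))) {?L}"
    by (rule bp.dag_weaken) simp_all
  moreover have "realizes (insert ?t (sym_set A \<union> tok v ` {1..j})) ?L"
  proof (rule realizes_loop[OF L(2)])
    show "?t \<notin> sym_set A \<union> tok v ` {1..j}" using v(2) by (auto simp: sym_set_def)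
    show "set ss \<subseteq> sym_set A \<union> tok v ` {1..j} \<and> sum_list (map sym_degree ss) \<le> sym_degree ?t \<and>
        (\<forall>s\<in>set ss. sym_degree s > 0)" if "(w, ss) \<in> set ?rs" for w ss
      using rules[OF that] by (simp add: le_supI1)
    show "sym_value e ?t = (\<Sum>(w, ss)\<leftarrow>?rs. input_poly w * prod_list (map (sym_value e) ss))"
      if "e \<in> assignments" for e
      using that by (rule gate_rules_value[OF v(1) i])
  qed
  moreover have "insert ?t (sym_set A \<union> tok v ` {1..j}) = sym_set A \<union> tok v ` {1..Suc j}"
    by (auto simp: atLeastAtMostSuc_conv)
  ultimately show ?case by (intro exI[of _ ?L]) simp
qed

lemma ex_next_gate:
  assumes "A \<subset> gates C"
  obtains v where "v \<in> gates C" "v \<notin> A" "predecessors (gate_label C v) \<subseteq> A"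
proof -
  have "circuit_edges C \<subseteq> gates C \<times> gates C" "finite (gates C \<times> gates C)"
    using circuit by (simp_all add: is_circuit_def)
  then have "finite (circuit_edges C)" by (rule finite_subset)
  then have wf: "wf (circuit_edges C)"
    using circuit by (simp add: is_circuit_def finite_acyclic_wf)
  obtain x where x: "x \<in> gates C - A" using assms by blast
  obtain v where v: "v \<in> gates C - A"
    "\<And>u. (u, v) \<in> circuit_edges C \<Longrightarrow> u \<notin> gates C - A"
    by (rule wfE_min[OF wf x]) (rule that)
  have pred: "predecessors (gate_label C v) \<subseteq> A"
  proof
    fix u assume u: "u \<in> predecessors (gate_label C v)"
    have "v \<in> gates C" using v(1) by simp
    then have "u \<in> gates C" using u by (rule pred_in_gates)
    moreover have "(u, v) \<in> circuit_edges C"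
      using \<open>v \<in> gates C\<close> u by (simp add: circuit_edges_def)
    then have "u \<notin> gates C - A" by (rule v(2))
    ultimately show "u \<in> A" by simp
  qed
  from v(1) have "v \<in> gates C" "v \<notin> A" by simp_all
  then show thesis using pred by (rule that)
qed

text \<open>The program grows backwards from the sink, so gates are added predecessors first,
  although a walk meets the output first.\<close>

lemma gates_stage:
  assumes "k \<le> card (gates C)"
  shows "\<exists>A K. A \<subseteq> gates C \<and> card A = k \<and>
    dag bp_step {sink_value} (p * (7 * D + 1) + k * (D * (D * (4 * D + 7)))) {K} \<and> realizes (sym_set A) K"
  using assms
proof (induction k)
  case 0
  obtain K where K: "dag bp_step {sink_value} (p * (7 * D + 1)) {K}"
    "\<forall>M. good M \<longrightarrow> K M = bit_value p M"
    using bit_stage[of p] by auto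
  then have "realizes (sym_set {}) K" by (simp add: realizes_def sym_set_def bit_value_eq)
  then show ?case using K(1) by (intro exI[of _ "{}"] exI[of _ K]) simp
next
  case (Suc k)
  then obtain A K where A: "A \<subseteq> gates C" "card A = k"
    and K: "dag bp_step {sink_value} (p * (7 * D + 1) + k * (D * (D * (4 * D + 7)))) {K}"
      "realizes (sym_set A) K" by auto
  have fin: "finite (gates C)" using circuit by (simp add: is_circuit_def)
  have "A \<subset> gates C" using A Suc.prems by auto
  then obtain v where v: "v \<in> gates C" "v \<notin> A" "predecessors (gate_label C v) \<subseteq> A"
    by (rule ex_next_gate)
  obtain L where L: "dag bp_step {K} (D * (D * (4 * D + 7))) {L}"
    "realizes (sym_set A \<union> tok v ` {1..D}) L"
    using gate_stage[OF K(2) v order_refl] by (elim exE conjE) (rule that)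
  have "dag bp_step ({sink_value} \<union> {K}) (D * (D * (4 * D + 7))) {L}"
    by (rule bp.dag_mono_start[OF L(1)]) simp
  from bp.dag_then[OF K(1) this]
  have "dag bp_step {sink_value} (p * (7 * D + 1) + Suc k * (D * (D * (4 * D + 7)))) {L}"
    by (rule bp.dag_weaken) simp_all
  moreover have "sym_set A \<union> tok v ` {1..D} = sym_set (insert v A)" by (auto simp: sym_set_def)
  moreover have "card (insert v A) = Suc k"
    using A v(2) finite_subset[OF A(1) fin] by simp
  ultimately show ?case
    using L(2) A(1) v(1) by (intro exI[of _ "insert v A"] exI[of _ L]) simp
qed

lemma boolean_sum_rabp:
  assumes f: "circuit_computes C g" "mp_degree g \<le> D"
  obtains G :: "(nat, nat, nat, 'a) rabp"
  where "rabp_computes G (\<Sum>e\<in>assignments. mp_subst (assign e) g)"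
    "rabp_size G \<le> p * (7 * D + 1) + card (gates C) * (D * (D * (4 * D + 7))) + (4 * (D + 1) + 2)"
proof -
  define out where "out = output_gate C"
  have out: "out \<in> gates C" using circuit by (simp add: is_circuit_def out_def)
  have g: "gate_poly out = g"
    using f(1) by (intro gate_poly_eq) (simp add: circuit_computes_def out_def)
  obtain A K where A: "A \<subseteq> gates C" "card A = card (gates C)"
    and K: "dag bp_step {sink_value} (p * (7 * D + 1) + card (gates C) * (D * (D * (4 * D + 7)))) {K}"
      "realizes (sym_set A) K"
    using gates_stage[OF order_refl] by (elim exE conjE) (rule that)
  have "finite (gates C)" using circuit by (simp add: is_circuit_def)
  then have "A = gates C" using A by (rule card_subset_eq)
  \<comment> \<open>The source splits the output into its components: degree 0 as a weight with
    nothing written, every other degree as one symbol.\<close>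
  define rs :: "((nat, 'a) input \<times> nat list) list" where
    "rs = (Constant (Poly_Mapping.lookup g 0), []) # map (\<lambda>i. (Constant 1, [tok out i])) [1..<Suc D]"
  have len: "length rs = D + 1" by (simp add: rs_def)
  have "dag bp_step ({sink_value} \<union> {K}) (4 * length rs + 1) {rules_apply rs K}"
    by (rule bp_rules) (auto simp: rs_def)
  with K(1) have "dag bp_step {sink_value}
      (p * (7 * D + 1) + card (gates C) * (D * (D * (4 * D + 7))) + (4 * length rs + 1)) {rules_apply rs K}"
    by (rule bp.dag_then)
  then obtain G :: "(nat, nat, nat, 'a) rabp" where G: "rabp_computes G (rules_apply rs K {#})"
    "rabp_size G \<le> Suc (p * (7 * D + 1) + card (gates C) * (D * (D * (4 * D + 7))) + (4 * length rs + 1))"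
    by (rule bp_dag_rabp)
  have "K {#tok out i#} = (\<Sum>e\<in>assignments. coeff (grading (assign e) g) i)" if "i \<in> {1..D}" for i
  proof -
    have "good {#tok out i#}" using that by (simp add: good_def)
    moreover have "tok out i \<in> sym_set A" using that out \<open>A = gates C\<close> by simp
    ultimately show ?thesis using K(2) by (simp add: realizes_def value_on_def g)
  qed
  \<comment> \<open>The empty memory is worth 1 for each assignment, so the constant component is
    counted once per assignment, as the Boolean sum requires.\<close>
  moreover have "K {#} = (\<Sum>e\<in>assignments. 1)"
    using K(2) by (simp add: realizes_def value_on_def good_def)
  ultimately have "rules_apply rs K {#} =
      (\<Sum>e\<in>assignments. coeff (grading (assign e) g) 0) +
      (\<Sum>i\<in>{1..D}. \<Sum>e\<in>assignments. coeff (grading (assign e) g) i)"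
    by (simp add: rules_apply_def rs_def o_def interv_sum_list_conv_sum_set_nat grading_coeff_0
        mult.commute atLeastLessThanSuc_atLeastAtMost del: upt_Suc)
  also have "\<dots> = (\<Sum>e\<in>assignments. \<Sum>i\<le>D. coeff (grading (assign e) g) i)"
  proof -
    have split: "{..D} = insert 0 {1..D}" by auto
    show ?thesis
      unfolding split sum.swap[of _ assignments "{1..D}"] sum.distrib[symmetric] by simp
  qed
  also have "\<dots> = (\<Sum>e\<in>assignments. mp_subst (assign e) g)"
    using f(2) by (simp add: mp_subst_eq_sum_coeff)
  finally show thesis using G len by (intro that[of G]) simp_all
qed

end

lemma VNP_imp_rabp:
  fixes f :: "nat \<Rightarrow> (nat, 'a::field) mpoly"
  assumes "f \<in> VNP"
  shows "\<exists>(b :: nat poly) (G :: nat \<Rightarrow> (nat, nat, nat, 'a) rabp).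
    \<forall>n. rabp_computes (G n) (f n) \<and> rabp_size (G n) \<le> poly b n"
proof -
  obtain g :: "nat \<Rightarrow> (nat + nat, 'a) mpoly" and p q :: "nat poly" and X :: "nat \<Rightarrow> nat set"
    where "g \<in> VP" and X: "\<forall>n. finite (X n) \<and> card (X n) = poly q n \<and>
         mp_vars (g n) \<subseteq> Inl ` {..<poly p n} \<union> Inr ` X n \<and>
         f n = (\<Sum>e \<in> {..<poly p n} \<rightarrow>\<^sub>E {0, 1}.
                  mp_subst (case_sum (\<lambda>i. mp_const (e i)) mp_var) (g n))"
    using assms unfolding VNP_def mem_Collect_eq by (elim bexE exE) (rule that)
  then have f: "f n = (\<Sum>e \<in> {..<poly p n} \<rightarrow>\<^sub>E {0, 1}.
      mp_subst (case_sum (\<lambda>i. mp_const (e i)) mp_var) (g n))" for n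
    by (elim allE conjE)
  obtain d :: "nat poly" where d: "\<forall>n. mp_degree (g n) \<le> poly d n"
    using \<open>g \<in> VP\<close> unfolding VP_def mem_Collect_eq by (elim conjE exE) (rule that)
  obtain s :: "nat poly" and C :: "nat \<Rightarrow> (nat, nat + nat, 'a) circuit" where
    C: "\<forall>n. circuit_computes (C n) (g n) \<and> circuit_size (C n) \<le> poly s n"
    using \<open>g \<in> VP\<close> unfolding VP_def mem_Collect_eq by (elim conjE exE) (rule that)
  define b where "b = p * (7 * d + 1) + s * (d * (d * (4 * d + 7))) + (4 * (d + 1) + 2)"
  have "\<exists>G :: (nat, nat, nat, 'a) rabp. rabp_computes G (f n) \<and> rabp_size G \<le> poly b n" for n
  proof -
    have Cn: "circuit_computes (C n) (g n)" "circuit_size (C n) \<le> poly s n" using C by simp_all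
    interpret boolean_sum_circuit "C n" "poly d n" "poly p n"
      using Cn(1) by unfold_locales (simp add: circuit_computes_def)
    obtain G :: "(nat, nat, nat, 'a) rabp" where
      G: "rabp_computes G (\<Sum>e\<in>assignments. mp_subst (assign e) (g n))"
      "rabp_size G \<le> poly p n * (7 * poly d n + 1) +
        card (gates (C n)) * (poly d n * (poly d n * (4 * poly d n + 7))) + (4 * (poly d n + 1) + 2)"
      by (rule boolean_sum_rabp[OF Cn(1) spec[OF d]]) (rule that)
    have sum: "f n = (\<Sum>e\<in>assignments. mp_subst (assign e) (g n))"
      unfolding f assignments_def assign_def by (rule refl)
    have gates: "card (gates (C n)) * (poly d n * (poly d n * (4 * poly d n + 7))) \<le>
        poly s n * (poly d n * (poly d n * (4 * poly d n + 7)))"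
      using Cn(2) by (intro mult_le_mono1) (simp add: circuit_size_def)
    have "rabp_size G \<le> poly p n * (7 * poly d n + 1) +
        poly s n * (poly d n * (poly d n * (4 * poly d n + 7))) + (4 * (poly d n + 1) + 2)"
      by (rule order_trans[OF G(2)]) (intro add_mono order_refl gates)
    also have "\<dots> = poly b n"
      by (simp only: b_def poly_add poly_mult poly_numeral poly_1)
    finally show ?thesis using G(1) unfolding sum by blast
  qed
  then have "\<forall>n. \<exists>G :: (nat, nat, nat, 'a) rabp. rabp_computes G (f n) \<and> rabp_size G \<le> poly b n"
    by (rule allI)
  from choice[OF this] show ?thesis by (rule exI)
qed

section \<open>From branching programs to walks on indices\<close>

text \<open>\<open>m\<close> is only an upper bound on the number of vertices, because the number of
  Boolean variables in \<open>VNP\<close> must be the value of a polynomial. Some indices below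
  \<open>m\<close> may therefore name no vertex.\<close>

locale indexed_rabp = rabp G for G :: "('v, 's, nat, 'a::field) rabp" +
  fixes m :: nat and h :: "'v \<Rightarrow> nat"
  assumes inj_h: "inj_on h (pverts (rabp_graph G))"
    and h_less: "u \<in> pverts (rabp_graph G) \<Longrightarrow> h u < m"
begin

text \<open>Vertices are identified with indices below \<open>m\<close>. The edges leaving the sink are replaced by a
  neutral loop, so that the source-sink paths become walks of length exactly \<open>m\<close>.\<close>

definition vertex :: "nat \<Rightarrow> 'v" where
  "vertex = inv_into V h"

definition is_edge :: "nat \<Rightarrow> nat \<Rightarrow> bool" where
  "is_edge a b \<longleftrightarrow> a \<in> h ` V \<and> b \<in> h ` V \<and> (vertex a, vertex b) \<in> E \<and> vertex a \<noteq> rabp_sink G"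

definition wt :: "nat \<Rightarrow> nat \<Rightarrow> (nat, 'a) input" where
  "wt a b = (if is_edge a b then rabp_weight G (vertex a, vertex b)
     else if a = h (rabp_sink G) \<and> b = a then Constant 1 else Constant 0)"

definition op :: "nat \<Rightarrow> nat \<Rightarrow> 's memop" where
  "op a b = (if is_edge a b then rabp_op G (vertex a, vertex b) else Nop)"

lemma sink_in_V: "rabp_sink G \<in> V" and source_in_V: "rabp_source G \<in> V"
  using is_rabp by (simp_all add: is_rabp_def)

lemma vertex_h: "u \<in> V \<Longrightarrow> vertex (h u) = u"
  unfolding vertex_def using inj_h by (rule inv_into_f_f)

lemma h_eq_iff: "u \<in> V \<Longrightarrow> v \<in> V \<Longrightarrow> h u = h v \<longleftrightarrow> u = v"
  using inj_h by (rule inj_on_eq_iff)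

lemma is_edge_h: "u \<in> V \<Longrightarrow> v \<in> V \<Longrightarrow> is_edge (h u) (h v) \<longleftrightarrow> (u, v) \<in> E \<and> u \<noteq> rabp_sink G"
  by (simp add: is_edge_def vertex_h)

text \<open>Defined for every list of indices, walk or not: steps that are neither edges nor the
  loop at the sink have weight 0 and cancel the list.\<close>

primrec chain :: "nat \<Rightarrow> nat list \<Rightarrow> 's multiset \<Rightarrow> (nat, 'a) mpoly" where
  "chain a [] = (\<lambda>M. if a = h (rabp_sink G) \<and> M = {#} then 1 else 0)"
| "chain a (b # bs) = op_apply (wt a b) (op a b) (chain b bs)"

definition vlists :: "nat \<Rightarrow> nat list set" where
  "vlists k = {bs. length bs = k \<and> set bs \<subseteq> {..<m}}"

lemma vlists_0: "vlists 0 = {[]}"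
  by (auto simp: vlists_def)

lemma vlists_Suc: "vlists (Suc k) = (\<lambda>(b, bs). b # bs) ` ({..<m} \<times> vlists k)"
  by (auto simp: vlists_def length_Suc_conv image_iff)

lemma op_apply_sum: "op_apply w a (\<lambda>M. \<Sum>x\<in>X. F x M) M = (\<Sum>x\<in>X. op_apply w a (F x) M)"
  by (cases "mem_step a M") (simp_all add: op_apply_def sum_distrib_left)

lemma sum_vlists_Suc:
  "(\<Sum>bs\<in>vlists (Suc k). chain a bs M) =
     (\<Sum>b<m. op_apply (wt a b) (op a b) (\<lambda>M. \<Sum>bs\<in>vlists k. chain b bs M) M)"
proof -
  have "inj_on (\<lambda>(b, bs). b # bs) ({..<m} \<times> vlists k)" by (auto simp: inj_on_def)
  then have "(\<Sum>bs\<in>vlists (Suc k). chain a bs M) =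
      (\<Sum>(b, bs)\<in>{..<m} \<times> vlists k. chain a (b # bs) M)"
    unfolding vlists_Suc by (subst sum.reindex) (auto simp: case_prod_unfold)
  also have "\<dots> = (\<Sum>b<m. \<Sum>bs\<in>vlists k. chain a (b # bs) M)"
    by (rule sum.cartesian_product[symmetric])
  finally show ?thesis by (simp add: op_apply_sum)
qed

lemma op_apply_0: "op_apply (Constant 0) a K M = 0"
  by (simp add: op_apply_def)

lemma sum_chain_sink:
  "(\<Sum>bs\<in>vlists k. chain (h (rabp_sink G)) bs M) = (if M = {#} then 1 else 0)"
proof (induction k arbitrary: M)
  case 0
  show ?case by (simp add: vlists_0)
next
  case (Suc k)
  let ?t = "h (rabp_sink G)"
  have no_edge: "\<not> is_edge ?t b" for b
    by (simp add: is_edge_def vertex_h sink_in_V)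
  have "(\<Sum>bs\<in>vlists (Suc k). chain ?t bs M) =
      (\<Sum>b<m. if b = ?t then (if M = {#} then 1 else 0) else 0)"
    unfolding sum_vlists_Suc
    by (rule sum.cong) (simp_all add: wt_def op_def no_edge op_apply_0 op_apply_Nop Suc.IH)
  also have "\<dots> = (if M = {#} then 1 else 0)"
    using h_less[OF sink_in_V] by simp
  finally show ?case .
qed

lemma succ_in_V: "(u, v) \<in> E \<Longrightarrow> v \<in> V"
  by (rule arc_snd_in_verts[of "(u, v)", simplified])

text \<open>Its cardinality drops along every edge and thus bounds the number of steps of a
  walk.\<close>

definition descendants :: "'v \<Rightarrow> 'v set" where
  "descendants u = {v. (u, v) \<in> E\<^sup>+}"

lemma descendants_subset: "descendants u \<subseteq> V"
proof
  fix v assume "v \<in> descendants u"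
  then have "(u, v) \<in> E\<^sup>+" by (simp add: descendants_def)
  then obtain w where "(w, v) \<in> E" by (meson tranclE)
  then show "v \<in> V" by (rule succ_in_V)
qed

lemma card_descendants:
  assumes "(u, v) \<in> E"
  shows "card (descendants v) < card (descendants u)"
proof (rule psubset_card_mono)
  show "finite (descendants u)"
    using descendants_subset pair_finite_verts by (rule finite_subset)
  have "v \<in> descendants u" using assms by (simp add: descendants_def)
  moreover have "v \<notin> descendants v" using acyclic_E by (simp add: descendants_def acyclic_def)
  moreover have "descendants v \<subseteq> descendants u"
    using assms by (auto simp: descendants_def intro: trancl_into_trancl2)
  ultimately show "descendants v \<subset> descendants u" by blast
qed

text \<open>Every walk from \<open>u\<close> has at most \<open>k\<close> edges, and the loop at the
  sink pads it to length exactly \<open>k\<close> in just one way.\<close>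

lemma sum_chain:
  assumes "u \<in> V" "card (descendants u) \<le> k"
  shows "(\<Sum>bs\<in>vlists k. chain (h u) bs M) = walk_sum G u M"
  using assms
proof (induction k arbitrary: u M)
  case 0
  show ?case
  proof (cases "u = rabp_sink G")
    case True
    then show ?thesis by (simp add: sum_chain_sink walk_sum_sink)
  next
    case False
    have "{v. (u, v) \<in> E} = {}" using card_descendants[of u] 0(2) by fastforce
    then have "walk_sum G u M = 0" using False by (simp add: walk_sum_unfold)
    then show ?thesis using False 0(1) by (simp add: vlists_0 h_eq_iff sink_in_V)
  qed
next
  case (Suc k)
  show ?case
  proof (cases "u = rabp_sink G")
    case True
    then show ?thesis by (simp add: sum_chain_sink walk_sum_sink)
  next
    case False
    let ?g = "\<lambda>b. op_apply (wt (h u) b) (op (h u) b) (\<lambda>M. \<Sum>bs\<in>vlists k. chain b bs M) M"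
    have IH: "(\<lambda>M. \<Sum>bs\<in>vlists k. chain (h v) bs M) = walk_sum G v" if "(u, v) \<in> E" for v
      using card_descendants[OF that] Suc.prems(2) by (intro ext Suc.IH succ_in_V[OF that]) simp
    have zero: "?g b = 0" if "b \<notin> h ` {v. (u, v) \<in> E}" for b
    proof -
      have "\<not> is_edge (h u) b"
      proof
        assume e: "is_edge (h u) b"
        then obtain v where "v \<in> V" "b = h v" by (auto simp: is_edge_def)
        then show False using e that is_edge_h[OF Suc.prems(1)] by blast
      qed
      then have "wt (h u) b = Constant 0"
        using False Suc.prems(1) by (simp add: wt_def h_eq_iff sink_in_V)
      then show ?thesis by (simp add: op_apply_0)
    qed
    have "(\<Sum>bs\<in>vlists (Suc k). chain (h u) bs M) = (\<Sum>b<m. ?g b)"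
      by (rule sum_vlists_Suc)
    also have "\<dots> = (\<Sum>b\<in>h ` {v. (u, v) \<in> E}. ?g b)"
    proof (rule sum.mono_neutral_right)
      show "h ` {v. (u, v) \<in> E} \<subseteq> {..<m}"
        by (auto intro: h_less succ_in_V)
    qed (simp_all add: zero)
    also have "\<dots> = (\<Sum>v | (u, v) \<in> E. ?g (h v))"
    proof (rule sum.reindex_cong[OF _ refl refl])
      show "inj_on h {v. (u, v) \<in> E}"
        by (rule inj_on_subset[OF inj_h]) (auto intro: succ_in_V)
    qed
    also have "\<dots> = walk_sum G u M"
      unfolding walk_sum_unfold[OF False]
    proof (rule sum.cong[OF refl])
      fix v assume "v \<in> {v. (u, v) \<in> E}"
      then have v: "(u, v) \<in> E" by simp
      have "is_edge (h u) (h v)" using v False succ_in_V[OF v] Suc.prems(1) by (simp add: is_edge_h)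
      then show "?g (h v) = op_apply (rabp_weight G (u, v)) (rabp_op G (u, v)) (walk_sum G v) M"
        using succ_in_V[OF v] Suc.prems(1) by (simp add: IH[OF v] wt_def op_def vertex_h)
    qed
    finally show ?thesis .
  qed
qed

lemma card_V_le: "card V \<le> m"
proof -
  have "card V \<le> card {..<m}"
    by (rule card_inj_on_le[OF inj_h]) (auto intro: h_less)
  then show ?thesis by simp
qed

lemma walk_sum_eq_sum_chain:
  "walk_sum G (rabp_source G) {#} = (\<Sum>bs\<in>vlists m. chain (h (rabp_source G)) bs {#})"
proof (rule sum_chain[OF source_in_V, symmetric])
  have "card (descendants (rabp_source G)) \<le> card V"
    by (rule card_mono[OF pair_finite_verts descendants_subset])
  then show "card (descendants (rabp_source G)) \<le> m" using card_V_le by simp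
qed

primrec chain_ops :: "nat \<Rightarrow> nat list \<Rightarrow> 's memop list" where
  "chain_ops a [] = []"
| "chain_ops a (b # bs) = op a b # chain_ops b bs"

lemma chain_ops_nth: "i < length bs \<Longrightarrow> chain_ops a bs ! i = op ((a # bs) ! i) (bs ! i)"
  by (induction bs arbitrary: a i) (auto simp: nth_Cons split: nat.split)

lemma length_chain_ops: "length (chain_ops a bs) = length bs"
  by (induction bs arbitrary: a) simp_all

text \<open>Unrolls the recursion into an end condition, a memory condition and a product of
  weights, which \<open>walk_poly\<close> can represent by separate factors.\<close>

lemma chain_eq:
  "chain a bs M = (if (a # bs) ! length bs = h (rabp_sink G) \<and> mem_run (chain_ops a bs) M = Some {#}
     then \<Prod>i<length bs. input_poly (wt ((a # bs) ! i) (bs ! i)) else 0)"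
proof (induction bs arbitrary: a M)
  case (Cons b bs)
  have "(\<Prod>i<Suc (length bs). input_poly (wt ((a # b # bs) ! i) ((b # bs) ! i))) =
      input_poly (wt a b) * (\<Prod>i<length bs. input_poly (wt ((b # bs) ! i) (bs ! i)))"
    by (simp add: prod.lessThan_Suc_shift del: prod.lessThan_Suc)
  then show ?case
    by (simp add: op_apply_def Cons.IH del: prod.lessThan_Suc split: option.split)
qed simp

end

section \<open>Walks as Boolean assignments\<close>

context indexed_rabp
begin

text \<open>The Boolean variable \<open>Inl (i * m + b)\<close> states that \<open>b\<close> is the vertex reached after \<open>i + 1\<close> steps.\<close>

definition at_vertex :: "nat \<Rightarrow> nat \<Rightarrow> (nat + nat, 'a) input" where
  "at_vertex i b = (case i of 0 \<Rightarrow> Constant (if b = h (rabp_source G) then 1 else 0)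
     | Suc j \<Rightarrow> Variable (Inl (j * m + b)))"

abbreviation "X i b \<equiv> input_poly (at_vertex i b) :: (nat + nat, 'a) mpoly"

text \<open>A table lookup: at an encoded walk only the summand of the edge taken at time
  \<open>i\<close> survives.\<close>

definition step_poly :: "nat \<Rightarrow> (nat \<Rightarrow> nat \<Rightarrow> (nat + nat, 'a) input) \<Rightarrow> (nat + nat, 'a) mpoly" where
  "step_poly i F = (\<Sum>(a, b)\<in>{..<m} \<times> {..<m}. X i a * X (Suc i) b * input_poly (F a b))"

text \<open>On Boolean values this is the indicator that exactly one vertex is marked; with two
  marks every summand has a factor \<open>1 - 1\<close>.\<close>

definition unique_poly :: "nat \<Rightarrow> (nat + nat, 'a) mpoly" where
  "unique_poly i = (\<Sum>b<m. X (Suc i) b *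
     (\<Prod>b'\<in>{..<m} - {b}. input_poly (Constant 1) + input_poly (Constant (- 1)) * X (Suc i) b'))"

definition op_test :: "'s memop set \<Rightarrow> nat \<Rightarrow> nat \<Rightarrow> (nat + nat, 'a) input" where
  "op_test A a b = Constant (if op a b \<in> A then 1 else 0)"

text \<open>Dynamic programming from the end of the walk: \<open>balance_poly s i k\<close> tests whether the last \<open>i\<close>
  operations remove exactly the \<open>k\<close> copies of \<open>s\<close> in the memory.\<close>

primrec balance_poly :: "'s \<Rightarrow> nat \<Rightarrow> nat \<Rightarrow> (nat + nat, 'a) mpoly" where
  "balance_poly s 0 k = input_poly (Constant (if k = 0 then 1 else 0))"
| "balance_poly s (Suc i) k =
     balance_poly s i (Suc k) * step_poly (m - Suc i) (op_test {Write s}) +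
     ((if k = 0 then input_poly (Constant 0) else balance_poly s i (k - 1)) *
        step_poly (m - Suc i) (op_test {Delete s}) +
      balance_poly s i k * step_poly (m - Suc i) (op_test (- {Write s, Delete s})))"

text \<open>The declared set \<open>rabp_symbols\<close> may be far larger than the program, but
  each edge mentions at most one symbol, so at most \<open>m * m\<close> tests are needed.\<close>

definition used_symbols :: "'s set" where
  "used_symbols = (\<Union>e\<in>E. set_memop (rabp_op G e))"

lemma set_memop_op: "set_memop (op a b) \<subseteq> used_symbols"
  by (auto simp: op_def is_edge_def used_symbols_def)

lemma set_chain_ops: "x \<in> set (chain_ops a cs) \<Longrightarrow> set_memop x \<subseteq> used_symbols"
  by (induction cs arbitrary: a) (use set_memop_op in auto)

lemma finite_used_symbols: "finite used_symbols"
proof -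
  have "finite (set_memop a)" for a :: "'s memop" by (cases a) simp_all
  then show ?thesis unfolding used_symbols_def using pair_finite_arcs by (intro finite_UN_I) simp_all
qed

text \<open>The \<open>unique_poly\<close> factors discard assignments that encode no list; the
  others reproduce \<open>chain\<close> on those that do.\<close>

definition walk_poly :: "(nat + nat, 'a) mpoly" where
  "walk_poly = (\<Prod>i<m. unique_poly i) * (X m (h (rabp_sink G)) *
     ((\<Prod>i<m. step_poly i (\<lambda>a b. map_input Inr id (wt a b))) * (\<Prod>s\<in>used_symbols. balance_poly s m 0)))"

abbreviation "ev e \<equiv> mp_eval mp_const (assign e)"

text \<open>One-hot blocks of length \<open>m\<close>, one block per time; \<open>undefined\<close>
  outside makes the assignment extensional.\<close>

definition encode :: "nat list \<Rightarrow> nat \<Rightarrow> 'a" where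
  "encode bs k = (if k < m * m then (if bs ! (k div m) = k mod m then 1 else 0) else undefined)"

lemma index_less: "i < m \<Longrightarrow> b < m \<Longrightarrow> i * m + b < m * m"
proof -
  assume "i < m" "b < m"
  then have "i * m + b < Suc i * m" by simp
  also have "\<dots> \<le> m * m" using \<open>i < m\<close> by (intro mult_le_mono1) simp
  finally show ?thesis .
qed

lemma encode_index: "i < m \<Longrightarrow> b < m \<Longrightarrow> encode bs (i * m + b) = (if bs ! i = b then 1 else 0)"
  by (simp add: encode_def index_less)

lemma encode_PiE: "encode bs \<in> {..<m * m} \<rightarrow>\<^sub>E {0, 1}"
  by (rule PiE_I) (simp_all add: encode_def)

lemma m_pos: "m > 0"
  using h_less[OF sink_in_V] by simp

section \<open>Evaluation at the encoding of an index list\<close>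

context
  fixes bs :: "nat list"
  assumes bs: "bs \<in> vlists m"
begin

abbreviation "st i \<equiv> (h (rabp_source G) # bs) ! i"

lemma length_bs: "length bs = m"
  using bs by (simp add: vlists_def)

lemma bs_less: "i < m \<Longrightarrow> bs ! i < m"
proof -
  assume "i < m"
  then have "bs ! i \<in> set bs" by (simp add: length_bs)
  then show ?thesis using bs by (auto simp: vlists_def)
qed

lemma st_less: "i \<le> m \<Longrightarrow> st i < m"
  using bs_less h_less[OF source_in_V] by (cases i) simp_all

lemma ev_at_vertex:
  assumes "i \<le> m" "b < m"
  shows "ev (encode bs) (X i b) = (if st i = b then 1 else 0)"
proof (cases i)
  case 0
  then show ?thesis by (simp add: at_vertex_def)
next
  case (Suc j)
  then show ?thesis using assms by (simp add: at_vertex_def assign_def encode_index)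
qed

lemma ev_step_poly:
  assumes "i < m"
  shows "ev (encode bs) (step_poly i F) = ev (encode bs) (input_poly (F (st i) (st (Suc i))))"
proof -
  have "ev (encode bs) (step_poly i F) = (\<Sum>x\<in>{..<m} \<times> {..<m}.
      if x = (st i, st (Suc i)) then ev (encode bs) (input_poly (F (fst x) (snd x))) else 0)"
    unfolding step_poly_def mp_const.eval_sum
  proof (rule sum.cong[OF refl])
    fix x assume "x \<in> {..<m} \<times> {..<m}"
    then obtain a b where x: "x = (a, b)" "a < m" "b < m" by auto
    show "ev (encode bs) (case x of (a, b) \<Rightarrow> X i a * X (Suc i) b * input_poly (F a b)) =
        (if x = (st i, st (Suc i)) then ev (encode bs) (input_poly (F (fst x) (snd x))) else 0)"
      using assms x(2,3) ev_at_vertex[of i a] ev_at_vertex[of "Suc i" b] by (simp add: x(1))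
  qed
  also have "\<dots> = ev (encode bs) (input_poly (F (st i) (st (Suc i))))"
    using assms st_less[of i] st_less[of "Suc i"] by simp
  finally show ?thesis .
qed

lemma ev_unique_poly:
  assumes "i < m"
  shows "ev (encode bs) (unique_poly i) = 1"
proof -
  have at: "ev (encode bs) (X (Suc i) b) = (if bs ! i = b then 1 else 0)" if "b < m" for b
    using ev_at_vertex[of "Suc i" b] that assms by simp
  have "ev (encode bs) (unique_poly i) = (\<Sum>b<m. if b = bs ! i then 1 else 0)"
    unfolding unique_poly_def mp_const.eval_sum
  proof (rule sum.cong[OF refl])
    fix b assume "b \<in> {..<m}"
    then have b: "b < m" by simp
    have "(\<Prod>b'\<in>{..<m} - {b}. ev (encode bs) (input_poly (Constant 1) +
        input_poly (Constant (- 1)) * X (Suc i) b')) = 1" if "b = bs ! i"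
      by (rule prod.neutral) (use that in \<open>simp add: at\<close>)
    then show "ev (encode bs) (X (Suc i) b * (\<Prod>b'\<in>{..<m} - {b}. input_poly (Constant 1) +
        input_poly (Constant (- 1)) * X (Suc i) b')) = (if b = bs ! i then 1 else 0)"
      using at[OF b] unfolding mp_const.eval_mult mp_const.eval_prod by simp
  qed
  also have "\<dots> = 1" using bs_less[OF assms] by simp
  finally show ?thesis .
qed

abbreviation "ops \<equiv> chain_ops (h (rabp_source G)) bs"

lemma drop_ops: "i < m \<Longrightarrow> drop i ops = op (st i) (st (Suc i)) # drop (Suc i) ops"
  using Cons_nth_drop_Suc[of i ops] by (simp add: length_chain_ops length_bs chain_ops_nth)

text \<open>The three operation classes partition all operations, so exactly one
  \<open>step_poly\<close> evaluates to 1, and the recursion becomes \<open>balanced_simps\<close>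
  for the operation at time \<open>m - Suc i\<close>.\<close>

lemma ev_balance_poly:
  assumes "i \<le> m"
  shows "ev (encode bs) (balance_poly s i k) = (if balanced s k (drop (m - i) ops) then 1 else 0)"
  using assms
proof (induction i arbitrary: k)
  case 0
  show ?case by (simp add: length_chain_ops length_bs balanced_simps)
next
  case (Suc i)
  let ?j = "m - Suc i"
  have j: "?j < m" "Suc ?j = m - i" using Suc.prems by simp_all
  have IH: "ev (encode bs) (balance_poly s i k) = (if balanced s k (drop (m - i) ops) then 1 else 0)" for k
    using Suc.IH Suc.prems by simp
  have test: "ev (encode bs) (step_poly ?j (op_test A)) =
      (if op (st ?j) (st (Suc ?j)) \<in> A then 1 else 0)" for A
    by (simp add: ev_step_poly[OF j(1)] op_test_def del: nth_Cons_Suc)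
  have drop: "drop ?j ops = op (st ?j) (st (Suc ?j)) # drop (m - i) ops"
    using drop_ops[OF j(1)] unfolding j(2) .
  obtain a where a: "op (st ?j) (st (Suc ?j)) = a" by simp
  show ?case
    unfolding balance_poly.simps mp_const.eval_add mp_const.eval_mult test drop a
    by (cases a) (auto simp: IH balanced_simps)
qed

lemma ev_walk_poly: "ev (encode bs) walk_poly = chain (h (rabp_source G)) bs {#}"
proof -
  have "ev (encode bs) (\<Prod>i<m. unique_poly i) = 1"
    unfolding mp_const.eval_prod by (rule prod.neutral) (simp add: ev_unique_poly)
  moreover have "ev (encode bs) (X m (h (rabp_sink G))) = (if st m = h (rabp_sink G) then 1 else 0)"
    by (rule ev_at_vertex[OF order_refl h_less[OF sink_in_V]])
  moreover have "ev (encode bs) (\<Prod>i<m. step_poly i (\<lambda>a b. map_input Inr id (wt a b))) =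
      (\<Prod>i<m. input_poly (wt (st i) (bs ! i)))"
    unfolding mp_const.eval_prod
  proof (rule prod.cong[OF refl])
    fix i assume "i \<in> {..<m}"
    then have "i < m" by simp
    have input: "ev (encode bs) (input_poly (map_input Inr id x)) = input_poly x" for x :: "(nat, 'a) input"
      by (cases x) (simp_all add: assign_def)
    show "ev (encode bs) (step_poly i (\<lambda>a b. map_input Inr id (wt a b))) = input_poly (wt (st i) (bs ! i))"
      unfolding ev_step_poly[OF \<open>i < m\<close>] input by simp
  qed
  moreover have "ev (encode bs) (\<Prod>s\<in>used_symbols. balance_poly s m 0) =
      (if mem_run ops {#} = Some {#} then 1 else 0)"
  proof -
    \<comment> \<open>Lists that are not walks are covered too: a step that is not an edge has
      operation \<open>Nop\<close>.\<close>
    have "mem_run ops {#} = Some {#} \<longleftrightarrow> (\<forall>s\<in>used_symbols. balanced s 0 ops)"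
      using realizable_iff_mem_run[of ops used_symbols] set_chain_ops
      by (simp add: realizable_iff_balanced)
    moreover have "(\<Prod>s\<in>S. if P s then 1 else 0 :: (nat, 'a) mpoly) = (if \<forall>s\<in>S. P s then 1 else 0)"
      if "finite S" for S :: "'s set" and P
      using that by (induction S) auto
    ultimately show ?thesis
      using finite_used_symbols by (simp add: ev_balance_poly)
  qed
  ultimately show ?thesis
    by (simp add: walk_poly_def chain_eq length_bs)
qed

end

lemma unique_poly_nonzero:
  assumes e: "e \<in> {..<m * m} \<rightarrow>\<^sub>E {0, 1}" and i: "i < m" and nz: "ev e (unique_poly i) \<noteq> 0"
  shows "\<exists>b<m. \<forall>b'<m. e (i * m + b') = (if b = b' then 1 else 0)"
proof -
  let ?t = "\<lambda>b. ev e (X (Suc i) b) *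
    (\<Prod>b'\<in>{..<m} - {b}. ev e (input_poly (Constant 1) + input_poly (Constant (- 1)) * X (Suc i) b'))"
  have X: "ev e (X (Suc i) b) = mp_const (e (i * m + b))" for b
    by (simp add: at_vertex_def assign_def)
  have bool: "e (i * m + b) = 0 \<or> e (i * m + b) = 1" if "b < m" for b
    using PiE_mem[OF e, of "i * m + b"] index_less[OF i that] by simp
  have "(\<Sum>b<m. ?t b) \<noteq> 0"
    using nz unfolding unique_poly_def mp_const.eval_sum mp_const.eval_mult mp_const.eval_prod .
  then obtain b where b: "b \<in> {..<m}" "?t b \<noteq> 0" by (rule sum.not_neutral_contains_not_neutral)
  have "e (i * m + b) = 1"
    using b bool[of b] by (auto simp: X)
  moreover have "e (i * m + b') = 0" if "b' < m" "b' \<noteq> b" for b'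
  proof (rule ccontr)
    assume "e (i * m + b') \<noteq> 0"
    then have "e (i * m + b') = 1" using bool[OF that(1)] by simp
    \<comment> \<open>A second marked vertex \<open>b'\<close> turns its factor in the product
      belonging to \<open>b\<close> into \<open>1 - 1\<close>.\<close>
    then have "ev e (input_poly (Constant 1) + input_poly (Constant (- 1)) * X (Suc i) b') = 0"
      using mp_const_add[of 1 "- 1 :: 'a"] by (simp add: X)
    then have "?t b = 0"
      using that by (intro mult_zero_right[THEN trans[rotated]] arg_cong2[of _ _ _ _ "(*)"] refl prod_zero) auto
    then show False using b by simp
  qed
  ultimately show ?thesis using b(1) by (intro exI[of _ b]) auto
qed

text \<open>The \<open>unique_poly\<close> factors suffice: each forces one block of
  \<open>m\<close> variables to be one-hot, and the marked positions spell the list.\<close>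

lemma encode_surj:
  assumes e: "e \<in> {..<m * m} \<rightarrow>\<^sub>E {0, 1}" and nz: "ev e walk_poly \<noteq> 0"
  shows "e \<in> encode ` vlists m"
proof -
  have "(\<Prod>i<m. ev e (unique_poly i)) \<noteq> 0"
    using nz unfolding walk_poly_def mp_const.eval_mult mp_const.eval_prod by auto
  then have "ev e (unique_poly i) \<noteq> 0" if "i < m" for i
    using that by (meson finite_lessThan lessThan_iff prod_zero)
  then have "\<forall>i\<in>{..<m}. \<exists>b. b < m \<and> (\<forall>b'<m. e (i * m + b') = (if b = b' then 1 else 0))"
    using unique_poly_nonzero[OF e] by simp
  from bchoice[OF this] obtain B where
    B: "\<forall>i\<in>{..<m}. B i < m \<and> (\<forall>b'<m. e (i * m + b') = (if B i = b' then 1 else 0))"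
    by (rule exE)
  have "map B [0..<m] \<in> vlists m" using B by (auto simp: vlists_def)
  moreover have "e = encode (map B [0..<m])"
  proof (rule PiE_ext[OF e encode_PiE])
    fix k assume "k \<in> {..<m * m}"
    then have k: "k < m * m" by simp
    have div: "k div m < m" using k by (simp add: less_mult_imp_div_less)
    have mod: "k mod m < m" using m_pos by simp
    have "e (k div m * m + k mod m) = (if B (k div m) = k mod m then 1 else 0)"
      using bspec[OF B, of "k div m"] div mod by blast
    then show "e k = encode (map B [0..<m]) k"
      using div k by (simp add: encode_def)
  qed
  ultimately show ?thesis by blast
qed

lemma inj_encode: "inj_on encode (vlists m)"
proof (rule inj_onI)
  fix bs cs assume bs: "bs \<in> vlists m" and cs: "cs \<in> vlists m" and eq: "encode bs = encode cs"
  show "bs = cs"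
  proof (rule nth_equalityI)
    show "length bs = length cs" using bs cs by (simp add: vlists_def)
    fix i assume "i < length bs"
    then have i: "i < m" using bs by (simp add: vlists_def)
    have "encode cs (i * m + bs ! i) = 1"
      unfolding eq[symmetric] using i bs_less[OF bs i] by (simp add: encode_index)
    then show "bs ! i = cs ! i"
      using i bs_less[OF bs i] by (simp add: encode_index split: if_splits)
  qed
qed

lemma sum_walk_poly:
  "(\<Sum>e\<in>{..<m * m} \<rightarrow>\<^sub>E {0, 1}. mp_subst (assign e) walk_poly) = walk_sum G (rabp_source G) {#}"
proof -
  have "(\<Sum>e\<in>{..<m * m} \<rightarrow>\<^sub>E {0, 1}. ev e walk_poly) = (\<Sum>e\<in>encode ` vlists m. ev e walk_poly)"
  proof (rule sum.mono_neutral_right)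
    show "finite ({..<m * m} \<rightarrow>\<^sub>E {0, 1 :: 'a})" by (intro finite_PiE) simp_all
    show "encode ` vlists m \<subseteq> {..<m * m} \<rightarrow>\<^sub>E {0, 1}" by (rule image_subsetI) (rule encode_PiE)
    show "\<forall>e\<in>({..<m * m} \<rightarrow>\<^sub>E {0, 1}) - encode ` vlists m. ev e walk_poly = 0"
      using encode_surj by blast
  qed
  also have "\<dots> = (\<Sum>bs\<in>vlists m. chain (h (rabp_source G)) bs {#})"
    by (rule sum.reindex_cong[OF inj_encode refl]) (simp add: ev_walk_poly)
  finally show ?thesis by (simp add: mp_subst_eq_eval walk_sum_eq_sum_chain)
qed

end

section \<open>Size and degree\<close>

text \<open>Polymorphic, so that they apply both to a size bound and to the polynomial describing it.\<close>

definition walk_size :: "'b::comm_semiring_1 \<Rightarrow> 'b" where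
  "walk_size m = (m * (m * (6 * m + 4) + 2) + 1) +
     ((m * (6 * (m * m) + 2) + 1) + (m * m * (m + m * (m * (18 * (m * m) + 9)) + 2) + 1)) + 4"

definition walk_degree :: "'b::comm_semiring_1 \<Rightarrow> 'b" where
  "walk_degree m = m * (m + 1) + (1 + (m * 3 + m * m * (m * 3)))"

lemma poly_walk_size: "poly (walk_size p) x = walk_size (poly p x)"
  by (simp add: walk_size_def)

lemma poly_walk_degree: "poly (walk_degree p) x = walk_degree (poly p x)"
  by (simp add: walk_degree_def)

lemma mp_degree_input: "mp_degree (input_poly x) \<le> 1"
  by (cases x) (simp_all add: mp_degree_var[unfolded One_nat_def])

lemma mp_degree_mult_le:
  fixes f g :: "('x, 'a::comm_ring_1) mpoly"
  shows "mp_degree f \<le> a \<Longrightarrow> mp_degree g \<le> b \<Longrightarrow> mp_degree (f * g) \<le> a + b"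
  by (rule order_trans[OF mp_degree_mult add_mono])

lemma mp_degree_add_le: "mp_degree f \<le> a \<Longrightarrow> mp_degree g \<le> a \<Longrightarrow> mp_degree (f + g) \<le> a"
  by (rule order_trans[OF mp_degree_add max.boundedI])

context indexed_rabp
begin

definition weight_vars :: "nat set" where
  "weight_vars = {x. \<exists>e\<in>E. rabp_weight G e = Variable x}"

definition inputs :: "(nat + nat, 'a) input set" where
  "inputs = range Constant \<union> Variable ` (Inl ` {..<m * m} \<union> Inr ` weight_vars)"

lemma Constant_in_inputs [simp]: "Constant c \<in> inputs"
  by (simp add: inputs_def)

lemma at_vertex_in_inputs:
  assumes "i \<le> m" "b < m"
  shows "at_vertex i b \<in> inputs"
  using assms by (cases i) (simp_all add: at_vertex_def inputs_def index_less)

lemma wt_in_inputs: "map_input Inr id (wt a b) \<in> inputs"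
proof (cases "is_edge a b")
  case True
  then have e: "(vertex a, vertex b) \<in> E" by (simp add: is_edge_def)
  show ?thesis
  proof (cases "rabp_weight G (vertex a, vertex b)")
    case (Constant c)
    then show ?thesis using True by (simp add: wt_def)
  next
    case (Variable x)
    then have "x \<in> weight_vars" using e unfolding weight_vars_def by blast
    then show ?thesis using True Variable by (simp add: wt_def inputs_def)
  qed
qed (simp add: wt_def)

abbreviation "R \<equiv> alg_step inputs"

lemma dag_X: "i \<le> m \<Longrightarrow> b < m \<Longrightarrow> dag R A 1 {X i b}"
  by (rule alg_input[OF at_vertex_in_inputs refl])

text \<open>Three inputs, two products and one addition for each pair of indices, and the initial
  0.\<close>

lemma dag_step_poly:
  assumes "i < m" "\<And>a b. F a b \<in> inputs"
  shows "dag R A (6 * (m * m) + 1) {step_poly i F}"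
proof -
  have "dag R A 5 {case x of (a, b) \<Rightarrow> X i a * X (Suc i) b * input_poly (F a b)}"
    if mem: "x \<in> {..<m} \<times> {..<m}" for x
  proof -
    obtain a b where x: "x = (a, b)" "a < m" "b < m" using mem by auto
    have "dag R A (Suc (Suc (1 + 1) + 1)) {X i a * X (Suc i) b * input_poly (F a b)}"
      using assms(1) x(2,3) by (intro alg_mult dag_X alg_input[OF assms(2) refl]) simp_all
    then show ?thesis unfolding x(1) prod.case by (rule alg.dag_weaken) simp_all
  qed
  then have "dag R A (card ({..<m} \<times> {..<m}) * Suc 5 + 1) {step_poly i F}"
    unfolding step_poly_def by (intro alg_sum_of) simp_all
  then show ?thesis by (rule alg.dag_weaken) simp_all
qed

text \<open>A factor \<open>1 - X\<close> takes 5 gates and one more to multiply it in, so a summand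
  costs at most \<open>6 * m + 3\<close>.\<close>

lemma dag_unique_poly:
  assumes "i < m"
  shows "dag R A (m * (6 * m + 4) + 1) {unique_poly i}"
proof -
  have "dag R A (6 * m + 3) {X (Suc i) b *
     (\<Prod>b'\<in>{..<m} - {b}. input_poly (Constant 1) + input_poly (Constant (- 1)) * X (Suc i) b')}"
    if "b \<in> {..<m}" for b
  proof -
    let ?f = "\<lambda>b'. input_poly (Constant 1) + input_poly (Constant (- 1)) * X (Suc i) b'"
    have "dag R A (Suc (1 + Suc (1 + 1))) {?f b'}" if "b' \<in> {..<m} - {b}" for b'
      using assms that by (intro alg_add alg_mult dag_X alg_input[OF Constant_in_inputs refl]) simp_all
    then have "dag R A (card ({..<m} - {b}) * Suc (Suc (1 + Suc (1 + 1))) + 1) {\<Prod>b'\<in>{..<m} - {b}. ?f b'}"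
      by (intro alg_prod_of) simp_all
    moreover have "card ({..<m} - {b}) \<le> m"
      using card_mono[of "{..<m}" "{..<m} - {b}"] by simp
    ultimately have "dag R A (6 * m + 1) {\<Prod>b'\<in>{..<m} - {b}. ?f b'}"
      by (elim alg.dag_weaken) simp_all
    then have "dag R A (Suc (1 + (6 * m + 1))) {X (Suc i) b * (\<Prod>b'\<in>{..<m} - {b}. ?f b')}"
      using assms that by (intro alg_mult dag_X) simp_all
    then show ?thesis by (rule alg.dag_weaken) simp_all
  qed
  then have "dag R A (card {..<m} * Suc (6 * m + 3) + 1) {unique_poly i}"
    unfolding unique_poly_def by (intro alg_sum_of) simp_all
  then show ?thesis by (rule alg.dag_weaken) simp_all
qed

text \<open>The table is triangular: row \<open>i\<close> holds the counts up to
  \<open>m - i\<close>, so row \<open>Suc i\<close> finds its entry \<open>Suc k\<close> in row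
  \<open>i\<close>, and row \<open>m\<close> is just the wanted entry. An entry takes three
  \<open>step_poly\<close>, one constant, three products and two additions, in total
  \<open>18 * (m * m) + 9\<close>.\<close>

lemma dag_balance_poly: "dag R A (m + m * (m * (18 * (m * m) + 9)) + 1) {balance_poly s m 0}"
proof -
  let ?B = "\<lambda>i. balance_poly s i ` {..m - i}" and ?q = "6 * (m * m) + 1"
  have step: "dag R (?B i) (m * (18 * (m * m) + 9)) (?B (Suc i))" if "i < m" for i
  proof -
    have "dag R (?B i) (18 * (m * m) + 9) {balance_poly s (Suc i) k}" if "k \<in> {..m - Suc i}" for k
    proof -
      have k: "Suc k \<le> m - i" using that \<open>i < m\<close> by simp
      have mem: "dag R (?B i) 0 {balance_poly s i k'}" if "k' \<le> m - i" for k'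
        by (rule alg.dag_refl) (use that in simp)
      have "dag R (?B i) 1 {if k = 0 then input_poly (Constant 0) else balance_poly s i (k - 1)}"
      proof (cases "k = 0")
        case True
        have "dag R (?B i) 1 {input_poly (Constant 0)}"
          by (rule alg_input[OF Constant_in_inputs refl])
        then show ?thesis unfolding if_P[OF True] .
      next
        case False
        have "dag R (?B i) 1 {balance_poly s i (k - 1)}"
          by (rule alg.dag_weaken[OF mem]) (use k in simp_all)
        then show ?thesis using False by simp
      qed
      then have "dag R (?B i) (Suc (Suc (0 + ?q) + Suc (Suc (1 + ?q) + Suc (0 + ?q)))) {balance_poly s (Suc i) k}"
        unfolding balance_poly.simps
        by (intro alg_add alg_mult mem dag_step_poly) (use k that \<open>i < m\<close> in \<open>simp_all add: op_test_def\<close>)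
      then show ?thesis by (rule alg.dag_weaken) simp_all
    qed
    then have "dag R (?B i) (card {..m - Suc i} * (18 * (m * m) + 9)) (?B (Suc i))"
      by (intro alg.dag_image) simp_all
    moreover have "card {..m - Suc i} \<le> m" using that by simp
    then have "card {..m - Suc i} * (18 * (m * m) + 9) \<le> m * (18 * (m * m) + 9)"
      by (rule mult_le_mono1)
    ultimately show ?thesis by (rule alg.dag_weaken) simp
  qed
  have "dag R A (card {..m} * 1) (balance_poly s 0 ` {..m})"
    by (intro alg.dag_image alg_input[OF Constant_in_inputs] balance_poly.simps) simp_all
  then have "dag R A (Suc m) (?B 0)" by simp
  moreover have "dag R (A \<union> ?B 0) (m * (m * (18 * (m * m) + 9))) (?B m)"
    by (rule alg.dag_mono_start[OF alg.dag_iterate[where B = ?B, OF step]]) simp_all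
  ultimately have "dag R A (Suc m + m * (m * (18 * (m * m) + 9))) (?B m)"
    by (rule alg.dag_then)
  then show ?thesis by (rule alg.dag_weaken) simp_all
qed

lemma card_E_le: "card E \<le> m * m"
proof -
  have "E \<subseteq> V \<times> V"
    using arc_fst_in_verts arc_snd_in_verts by fastforce
  then have "card E \<le> card (V \<times> V)" by (intro card_mono) (simp_all add: pair_finite_verts)
  also have "\<dots> \<le> m * m" using card_V_le by (simp add: card_cartesian_product mult_le_mono)
  finally show ?thesis .
qed

lemma card_used_symbols: "card used_symbols \<le> m * m"
proof -
  have "card (set_memop a) \<le> 1" for a :: "'s memop" by (cases a) simp_all
  then have "(\<Sum>e\<in>E. card (set_memop (rabp_op G e))) \<le> (\<Sum>e\<in>E. 1)" by (rule sum_mono)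
  moreover have "card used_symbols \<le> (\<Sum>e\<in>E. card (set_memop (rabp_op G e)))"
    unfolding used_symbols_def using pair_finite_arcs by (rule card_UN_le)
  ultimately show ?thesis using card_E_le by simp
qed

lemma weight_vars: "finite weight_vars" "card weight_vars \<le> m * m"
proof -
  \<comment> \<open>The default 0 for constants is arbitrary; an inclusion suffices for the
    cardinality bound.\<close>
  define var :: "(nat, 'a) input \<Rightarrow> nat" where "var = (\<lambda>x. case x of Constant c \<Rightarrow> 0 | Variable y \<Rightarrow> y)"
  have sub: "weight_vars \<subseteq> (\<lambda>e. var (rabp_weight G e)) ` E"
    by (auto simp: weight_vars_def var_def intro: rev_image_eqI)
  then show "finite weight_vars" using pair_finite_arcs by (meson finite_imageI finite_subset)
  have "card weight_vars \<le> card ((\<lambda>e. var (rabp_weight G e)) ` E)"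
    using sub pair_finite_arcs by (intro card_mono) simp_all
  also have "\<dots> \<le> card E" using pair_finite_arcs by (rule card_image_le)
  finally show "card weight_vars \<le> m * m" using card_E_le by simp
qed

text \<open>The final 4 in \<open>walk_size\<close> is the gate for the sink test and the three
  products joining the four factors.\<close>

lemma dag_walk_poly: "dag R {} (walk_size m) {walk_poly}"
proof -
  let ?c = "m + m * (m * (18 * (m * m) + 9)) + 1"
  have U: "dag R {} (card {..<m} * Suc (m * (6 * m + 4) + 1) + 1) {\<Prod>i<m. unique_poly i}"
    by (intro alg_prod_of dag_unique_poly) simp_all
  have S: "dag R {} (card {..<m} * Suc (6 * (m * m) + 1) + 1)
      {\<Prod>i<m. step_poly i (\<lambda>a b. map_input Inr id (wt a b))}"
    by (intro alg_prod_of dag_step_poly wt_in_inputs) simp_all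
  have "dag R {} (card used_symbols * Suc ?c + 1) {\<Prod>s\<in>used_symbols. balance_poly s m 0}"
    by (intro alg_prod_of dag_balance_poly finite_used_symbols) simp_all
  moreover have "card used_symbols * Suc ?c \<le> m * m * Suc ?c"
    using card_used_symbols by (rule mult_le_mono1)
  ultimately have B: "dag R {} (m * m * Suc ?c + 1) {\<Prod>s\<in>used_symbols. balance_poly s m 0}"
    by (elim alg.dag_weaken) simp_all
  have "dag R {} 1 {X m (h (rabp_sink G))}"
    by (rule dag_X[OF order_refl h_less[OF sink_in_V]])
  from alg_mult[OF U alg_mult[OF this alg_mult[OF S B]]]
  show ?thesis
    unfolding walk_poly_def[symmetric] by (rule alg.dag_weaken) (simp_all add: walk_size_def)
qed

section \<open>Degree and variables of the walk polynomial\<close>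

lemma mp_degree_step_poly: "mp_degree (step_poly i F) \<le> 3"
proof -
  have "mp_degree (case x of (a, b) \<Rightarrow> X i a * X (Suc i) b * input_poly (F a b)) \<le> 3" for x
  proof -
    obtain a b where x: "x = (a, b)" by force
    have "mp_degree (X i a * X (Suc i) b * input_poly (F a b)) \<le> (1 + 1) + 1"
      by (intro mp_degree_mult_le mp_degree_input)
    then show ?thesis by (simp add: x)
  qed
  then show ?thesis unfolding step_poly_def by (rule mp_degree_sum_le)
qed

lemma mp_degree_unique_poly: "mp_degree (unique_poly i) \<le> m + 1"
  unfolding unique_poly_def
proof (rule mp_degree_sum_le)
  fix b
  let ?f = "\<lambda>b'. input_poly (Constant 1) + input_poly (Constant (- 1)) * X (Suc i) b'"
  have "mp_degree (?f b') \<le> 1" for b'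
  proof (rule mp_degree_add_le)
    have "mp_degree (input_poly (Constant (- 1)) * X (Suc i) b') \<le> 0 + 1"
      by (rule mp_degree_mult_le[OF _ mp_degree_input]) simp
    then show "mp_degree (input_poly (Constant (- 1)) * X (Suc i) b') \<le> 1" by simp
  qed simp
  then have "mp_degree (\<Prod>b'\<in>{..<m} - {b}. ?f b') \<le> card ({..<m} - {b}) * 1"
    by (intro mp_degree_prod_le)
  moreover have "card ({..<m} - {b}) \<le> m"
    using card_mono[of "{..<m}" "{..<m} - {b}"] by simp
  ultimately have "mp_degree (\<Prod>b'\<in>{..<m} - {b}. ?f b') \<le> m" by linarith
  then have "mp_degree (X (Suc i) b * (\<Prod>b'\<in>{..<m} - {b}. ?f b')) \<le> 1 + m"
    by (rule mp_degree_mult_le[OF mp_degree_input])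
  then show "mp_degree (X (Suc i) b * (\<Prod>b'\<in>{..<m} - {b}. ?f b')) \<le> m + 1" by simp
qed

lemma mp_degree_balance_poly: "mp_degree (balance_poly s i k) \<le> i * 3"
proof (induction i arbitrary: k)
  case 0
  show ?case by simp
next
  case (Suc i)
  have *: "mp_degree (f * step_poly j F) \<le> Suc i * 3" if "mp_degree f \<le> i * 3" for f j F
    using mp_degree_mult_le[OF that mp_degree_step_poly[of j F]] by simp
  have "mp_degree (if k = 0 then input_poly (Constant 0) else balance_poly s i (k - 1)) \<le> i * 3"
    using Suc.IH by simp
  then show ?case
    unfolding balance_poly.simps by (intro mp_degree_add_le * Suc.IH)
qed

lemma mp_degree_walk_poly: "mp_degree walk_poly \<le> walk_degree m"
proof -
  have U: "mp_degree (\<Prod>i<m. unique_poly i) \<le> card {..<m} * (m + 1)"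
    by (intro mp_degree_prod_le mp_degree_unique_poly)
  have S: "mp_degree (\<Prod>i<m. step_poly i (\<lambda>a b. map_input Inr id (wt a b))) \<le> card {..<m} * 3"
    by (intro mp_degree_prod_le mp_degree_step_poly)
  have "mp_degree (\<Prod>s\<in>used_symbols. balance_poly s m 0) \<le> card used_symbols * (m * 3)"
    by (intro mp_degree_prod_le mp_degree_balance_poly)
  also have "\<dots> \<le> m * m * (m * 3)" using card_used_symbols by (rule mult_le_mono1)
  finally have B: "mp_degree (\<Prod>s\<in>used_symbols. balance_poly s m 0) \<le> m * m * (m * 3)" .
  show ?thesis
    using mp_degree_mult_le[OF U mp_degree_mult_le[OF mp_degree_input[of "at_vertex m (h (rabp_sink G))"] mp_degree_mult_le[OF S B]]]
    unfolding walk_poly_def[symmetric] by (simp add: walk_degree_def)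
qed

lemma mp_vars_walk_poly: "mp_vars walk_poly \<subseteq> Inl ` {..<m * m} \<union> Inr ` weight_vars"
proof (rule alg_dag_vars[OF dag_walk_poly])
  fix x assume "x \<in> inputs"
  then show "mp_vars (input_poly x) \<subseteq> Inl ` {..<m * m} \<union> Inr ` weight_vars"
    by (auto simp: inputs_def mp_vars_def mp_const_def mp_var_def split: if_splits)
qed simp

end

lemma rabp_boolean_sum:
  fixes G :: "('v, 's, nat, 'a::field) rabp"
  assumes "rabp_computes G f" "rabp_size G \<le> m"
  obtains g :: "(nat + nat, 'a) mpoly" and C :: "(nat, nat + nat, 'a) circuit" and Y :: "nat set"
  where "circuit_computes C g" "circuit_size C \<le> walk_size m" "mp_degree g \<le> walk_degree m"
    "finite Y" "card Y = m * m" "mp_vars g \<subseteq> Inl ` {..<m * m} \<union> Inr ` Y"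
    "f = (\<Sum>e\<in>{..<m * m} \<rightarrow>\<^sub>E {0, 1}. mp_subst (case_sum (\<lambda>i. mp_const (e i)) mp_var) g)"
proof -
  interpret rabp G using assms(1) by unfold_locales (simp add: rabp_computes_def)
  obtain h where h: "bij_betw h V {0..<card V}"
    using ex_bij_betw_finite_nat[OF pair_finite_verts] by (rule exE)
  interpret indexed_rabp G m h
  proof
    show "inj_on h V" using h by (rule bij_betw_imp_inj_on)
    fix u assume "u \<in> V"
    then have "h u \<in> {0..<card V}" by (rule bij_betwE[OF h, rule_format])
    then show "h u < m" using assms(2) by (simp add: rabp_size_def)
  qed
  obtain C :: "(nat, nat + nat, 'a) circuit" where
    C: "circuit_computes C walk_poly" "circuit_size C \<le> walk_size m"
    using dag_walk_poly by (rule alg_dag_circuit)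
  \<comment> \<open>\<open>VNP\<close> prescribes the exact number of variables, so
    \<open>weight_vars\<close> is padded with fresh ones to \<open>m * m\<close> elements.\<close>
  have "infinite (UNIV - weight_vars)" using weight_vars(1) by simp
  from infinite_arbitrarily_large[OF this, of "m * m - card weight_vars"]
  obtain B where B: "finite B" "card B = m * m - card weight_vars" "B \<subseteq> UNIV - weight_vars" by blast
  have "card (weight_vars \<union> B) = m * m"
    using B weight_vars by (subst card_Un_disjoint) auto
  moreover have "mp_vars walk_poly \<subseteq> Inl ` {..<m * m} \<union> Inr ` (weight_vars \<union> B)"
    using mp_vars_walk_poly by blast
  moreover have "f = (\<Sum>e\<in>{..<m * m} \<rightarrow>\<^sub>E {0, 1}.
      mp_subst (case_sum (\<lambda>i. mp_const (e i)) mp_var) walk_poly)"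
    using assms(1) sum_walk_poly unfolding computes_iff assign_def by simp
  ultimately show thesis
    using C mp_degree_walk_poly B(1) weight_vars(1) by (intro that[of C walk_poly "weight_vars \<union> B"]) simp_all
qed

lemma rabp_imp_VNP:
  fixes f :: "nat \<Rightarrow> (nat, 'a::field) mpoly" and p :: "nat poly"
    and G :: "nat \<Rightarrow> (nat, nat, nat, 'a) rabp"
  assumes G: "\<And>n. rabp_computes (G n) (f n)" "\<And>n. rabp_size (G n) \<le> poly p n"
  shows "f \<in> VNP"
proof -
  let ?P = "\<lambda>n g C Y. circuit_computes C g \<and> circuit_size C \<le> walk_size (poly p n) \<and>
      mp_degree g \<le> walk_degree (poly p n) \<and> finite Y \<and> card Y = poly p n * poly p n \<and>
      mp_vars g \<subseteq> Inl ` {..<poly p n * poly p n} \<union> Inr ` Y \<and>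
      f n = (\<Sum>e\<in>{..<poly p n * poly p n} \<rightarrow>\<^sub>E {0, 1}.
        mp_subst (case_sum (\<lambda>i. mp_const (e i)) mp_var) g)"
  \<comment> \<open>Packing the three witnesses into a triple lets one application of choice keep
    polynomial, circuit and variables matched.\<close>
  have "\<forall>n. \<exists>x :: (nat + nat, 'a) mpoly \<times> (nat, nat + nat, 'a) circuit \<times> nat set.
      ?P n (fst x) (fst (snd x)) (snd (snd x))"
  proof
    fix n
    obtain g :: "(nat + nat, 'a) mpoly" and C :: "(nat, nat + nat, 'a) circuit" and Y :: "nat set"
      where "circuit_computes C g" "circuit_size C \<le> walk_size (poly p n)"
        "mp_degree g \<le> walk_degree (poly p n)" "finite Y" "card Y = poly p n * poly p n"
        "mp_vars g \<subseteq> Inl ` {..<poly p n * poly p n} \<union> Inr ` Y"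
        "f n = (\<Sum>e\<in>{..<poly p n * poly p n} \<rightarrow>\<^sub>E {0, 1}.
          mp_subst (case_sum (\<lambda>i. mp_const (e i)) mp_var) g)"
      using G by (rule rabp_boolean_sum)
    then show "\<exists>x :: (nat + nat, 'a) mpoly \<times> (nat, nat + nat, 'a) circuit \<times> nat set.
        ?P n (fst x) (fst (snd x)) (snd (snd x))"
      by (intro exI[of _ "(g, C, Y)"]) simp
  qed
  from choice[OF this] obtain F :: "nat \<Rightarrow> (nat + nat, 'a) mpoly \<times> (nat, nat + nat, 'a) circuit \<times> nat set"
    where F: "\<forall>n. ?P n (fst (F n)) (fst (snd (F n))) (snd (snd (F n)))"
    by (rule exE)
  define g where "g = (\<lambda>n. fst (F n))"
  have "g \<in> VP"
    unfolding VP_def mem_Collect_eq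
  proof (intro conjI exI allI)
    fix n
    show "mp_degree (g n) \<le> poly (walk_degree p) n" using F by (simp add: g_def poly_walk_degree)
    show "circuit_computes (fst (snd (F n))) (g n)" using F by (simp add: g_def)
    show "circuit_size (fst (snd (F n))) \<le> poly (walk_size p) n" using F by (simp add: poly_walk_size)
  qed
  moreover have "\<forall>n. finite (snd (snd (F n))) \<and> card (snd (snd (F n))) = poly (p * p) n \<and>
      mp_vars (g n) \<subseteq> Inl ` {..<poly (p * p) n} \<union> Inr ` snd (snd (F n)) \<and>
      f n = (\<Sum>e\<in>{..<poly (p * p) n} \<rightarrow>\<^sub>E {0, 1}.
        mp_subst (case_sum (\<lambda>i. mp_const (e i)) mp_var) (g n))"
    using F unfolding g_def poly_mult by blast
  ultimately show ?thesis unfolding VNP_def mem_Collect_eq by (intro bexI exI)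
qed

theorem theorem23:
  fixes f :: "nat \<Rightarrow> (nat, 'a::field) mpoly"
  shows "f \<in> VNP \<longleftrightarrow>
    (\<exists>(p :: nat poly) (G :: nat \<Rightarrow> (nat, nat, nat, 'a) rabp).
       \<forall>n. rabp_computes (G n) (f n) \<and> rabp_size (G n) \<le> poly p n)"
proof
  assume "f \<in> VNP"
  then show "\<exists>(p :: nat poly) (G :: nat \<Rightarrow> (nat, nat, nat, 'a) rabp).
       \<forall>n. rabp_computes (G n) (f n) \<and> rabp_size (G n) \<le> poly p n"
    by (rule VNP_imp_rabp)
next
  assume "\<exists>(p :: nat poly) (G :: nat \<Rightarrow> (nat, nat, nat, 'a) rabp).
       \<forall>n. rabp_computes (G n) (f n) \<and> rabp_size (G n) \<le> poly p n"
  then obtain p :: "nat poly" and G :: "nat \<Rightarrow> (nat, nat, nat, 'a) rabp"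
    where G: "\<forall>n. rabp_computes (G n) (f n) \<and> rabp_size (G n) \<le> poly p n" by (elim exE)
  show "f \<in> VNP" by (rule rabp_imp_VNP[of G f p]) (use G in simp_all)
qed

end
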